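(* Let $p\in\{0,1\}$, let $R$ and $V$ be $m\times m$ matrix functions on $D$ of the block form $$R=\mathrm{diag}\{\rho_1,\rho_2\},\qquad V=\begin{bmatrix}0&v_1\\ v_2&0\end{bmatrix},$$ let $V_t(x,t)$ be continuous in $(x,t)$ jointly, and let $R$ and $V$ satisfy in $D$ the matrix coupled dispersionless equations $$R_x=\frac{(-1)^p}{2}(VV_t+V_tV),\qquad V_{tx}=\frac12(VR+RV).$$ Let $n\in\mathbb N$, let $A_1,A_2,S(0,0)$ be invertible complex $n\times n$ matrices and let $\Pi_1(0,0),\Pi_2(0,0)$ be complex $n\times m$ matrices such that $$A_1S(0,0)-S(0,0)A_2=\Pi_1(0,0)\Pi_2(0,0)^*.$$ Then the matrix functions $\Pi_1(x,t)$, $\Pi_2(x,t)$, $S(x,t)$ (solutions, with the given values at $(0,0)$, of the linear systems (a)-(c) of the context) and, for $\lambda\ne0$, a wave function $w(x,t,\lambda)$ (an $m\times m$ solution of $w_x=Gw$, $w_t=Fw$ with $\det w(0,0,\lambda)\neq 0$) are well defined in $D$. Moreover, at the points of $D$ where $S(x,t)$ is invertible, the matrix functions $$\widetilde V:=V+\frac12 j^p(X_0-jX_0j),\qquad \widetilde R:=\frac1{2\mathrm i}\big(\widetilde Q_{-1}j+j\widetilde Q_{-1}\big)$$ have the block form $$\widetilde R=\mathrm{diag}\{\widetilde\rho_1,\widetilde\rho_2\},\qquad \widetilde V=\begin{bmatrix}0&\widetilde v_1\\ \widetilde v_2&0\end{bmatrix},$$ and satisfy $$\widetilde R_x=\frac{(-1)^p}{2}(\widetilde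 V\widetilde V_t+\widetilde V_t\widetilde V),\qquad \widetilde V_{tx}=\frac12(\widetilde V\widetilde R+\widetilde R\widetilde V).$$ The wave function $\widetilde w$ (with $\det\widetilde w(0,0,\lambda)\ne0$) corresponding to the transformed equations is given by $$\widetilde w(x,t,\lambda)=w_A(x,t,\lambda)\,w(x,t,\lambda),$$ that is, for $\lambda\notin\{0\}\cup\sigma(A_1)\cup\sigma(A_2)$, $\widetilde w_x=\widetilde G\widetilde w$ and $\widetilde w_t=\widetilde F\widetilde w$, where $$\widetilde G=\frac{\mathrm i}{4}\lambda j-\frac{\mathrm i}{2}j^{p+1}\widetilde V,\qquad \widetilde F=\frac1\lambda\big(-\mathrm i j\widetilde R+j^p\widetilde V_t\big).$$
   Context: Notation. $m_1,m_2\ge1$, $m=m_1+m_2$, $I_k$ is the $k\times k$ identity, $j=\begin{bmatrix}I_{m_1}&0\\0&-I_{m_2}\end{bmatrix}$. The blocks $\rho_k$ are $m_k\times m_k$ complex matrix functions, $v_1$ is $m_1\times m_2$ and $v_2$ is $m_2\times m_1$; subscripts $x,t$ denote partial derivatives; $^*$ is the conjugate transpose; $\sigma(A)$ is the spectrum of $A$. The domain is $D=\{(x,t):\ a_1<x<a_2,\ b_1<t<b_2\}$ with $-\infty\le a_1<0<a_2\le\infty$, $-\infty\le b_1<0<b_2\le\infty$ (so $(0,0)\in D$). Auxiliary systems: $G(x,t,\lambda)=\frac{\mathrm i}4\lambda j-\frac{\mathrm i}2 j^{p+1}V(x,t)$ and $F(x,t,\lambda)=\frac1\lambda\big(-\mathrm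 i jR(x,t)+j^pV_t(x,t)\big)$. Coefficients: $q_1=-\frac{\mathrm i}4 j$, $q_0=\frac{\mathrm i}2j^{p+1}V$, $Q_{-1}=\mathrm i jR-j^pV_t$. Linear systems: (a) $(\Pi_1)_x=\Pi_1q_0+A_1\Pi_1q_1$, $(\Pi_1)_t=A_1^{-1}\Pi_1Q_{-1}$; (b) $(\Pi_2)_x=-\Pi_2q_0^*-A_2^*\Pi_2q_1^*$, $(\Pi_2)_t=-(A_2^* )^{-1}\Pi_2Q_{-1}^*$; (c) $S_x=\Pi_1q_1\Pi_2^*$, $S_t=-A_1^{-1}\Pi_1Q_{-1}\Pi_2^*A_2^{-1}$. Further (at points where $S$ is invertible): $X_0=\Pi_2^*S^{-1}\Pi_1$, $X_{-1}=\Pi_2^*S^{-1}A_1^{-1}\Pi_1$, $Y_{-1}=\Pi_2^*A_2^{-1}S^{-1}\Pi_1$, $\widetilde Q_{-1}=(I_m-X_{-1})Q_{-1}(I_m+Y_{-1})$, and the Darboux matrix is $$w_A(x,t,\lambda)=I_m-\Pi_2(x,t)^*S(x,t)^{-1}(A_1-\lambda I_n)^{-1}\Pi_1(x,t).$$ A wave function corresponding to a solution of the equations is an $m\times m$ matrix solution, with nonzero determinant at $(0,0)$, of the associated pair of auxiliary linear systems.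
   Formalization: R and V are additionally assumed jointly continuous in (x,t) on D; without this the claim fails, e.g. V=0, R=r(t)diag{I,0} with r a step function satisfies all hypotheses, but w_t=Fw has no solution with det w(0,0)≠0. *)

theory Defs
  imports "HOL-Analysis.Analysis"
begin

text \<open>
  An \<open>a \<times> b\<close> complex matrix has type \<open>complex ^ 'b ^ 'a\<close>; the size \<open>m = m\<^sub>1 + m\<^sub>2\<close> is the
  cardinality of the sum type \<open>'m1 + 'm2\<close>. Matrix functions of \<open>(x, t)\<close> are curried functions of
  two real arguments, only their values on the domain being relevant.
\<close>

definition cscale :: "complex \<Rightarrow> complex ^ 'b ^ 'a \<Rightarrow> complex ^ 'b ^ 'a" (infixr "\<cdot>\<^sub>C" 75) where
  "c \<cdot>\<^sub>C A = (\<chi> i k. c * A $ i $ k)"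

definition adj :: "complex ^ 'b ^ 'a \<Rightarrow> complex ^ 'a ^ 'b" where
  "adj A = (\<chi> i k. cnj (A $ k $ i))"

definition spec :: "complex ^ 'n ^ 'n \<Rightarrow> complex set" where
  "spec A = {l. \<exists>v. v \<noteq> 0 \<and> A *v v = l *s v}"

definition four_block ::
  "complex ^ 'a::finite ^ 'a \<Rightarrow> complex ^ 'b::finite ^ 'a \<Rightarrow> complex ^ 'a ^ 'b \<Rightarrow> complex ^ 'b ^ 'b
    \<Rightarrow> complex ^ ('a + 'b) ^ ('a + 'b)" where
  "four_block A B C D = (\<chi> i k. case (i, k) of
      (Inl r, Inl s) \<Rightarrow> A $ r $ s
    | (Inl r, Inr s) \<Rightarrow> B $ r $ s
    | (Inr r, Inl s) \<Rightarrow> C $ r $ s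
    | (Inr r, Inr s) \<Rightarrow> D $ r $ s)"

definition block_diagonal :: "complex ^ ('a::finite + 'b::finite) ^ ('a + 'b) \<Rightarrow> bool" where
  "block_diagonal M \<longleftrightarrow> (\<exists>r1 r2. M = four_block r1 0 0 r2)"

definition block_offdiagonal :: "complex ^ ('a::finite + 'b::finite) ^ ('a + 'b) \<Rightarrow> bool" where
  "block_offdiagonal M \<longleftrightarrow> (\<exists>v1 v2. M = four_block 0 v1 v2 0)"

definition jmat :: "complex ^ ('a::finite + 'b::finite) ^ ('a + 'b)" where
  "jmat = four_block (mat 1) 0 0 (- mat 1)"

text \<open>Matrix powers of \<open>j\<close>; the overloaded power operation on vectors would act entrywise.\<close>

definition jpow :: "nat \<Rightarrow> complex ^ ('a::finite + 'b::finite) ^ ('a + 'b)" where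
  "jpow k = (((**) jmat) ^^ k) (mat 1)"


definition pd_t :: "(real \<Rightarrow> real \<Rightarrow> 'e::real_normed_vector) \<Rightarrow> real \<Rightarrow> real \<Rightarrow> 'e" where
  "pd_t f x t = vector_derivative (\<lambda>s. f x s) (at t)"

definition has_pd_x ::
  "(real \<Rightarrow> real \<Rightarrow> 'e::real_normed_vector) \<Rightarrow> 'e \<Rightarrow> real \<Rightarrow> real \<Rightarrow> bool" where
  "has_pd_x f d x t \<longleftrightarrow> ((\<lambda>s. f s t) has_vector_derivative d) (at x)"

definition has_pd_t ::
  "(real \<Rightarrow> real \<Rightarrow> 'e::real_normed_vector) \<Rightarrow> 'e \<Rightarrow> real \<Rightarrow> real \<Rightarrow> bool" where
  "has_pd_t f d x t \<longleftrightarrow> ((\<lambda>s. f x s) has_vector_derivative d) (at t)"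

definition dom_rect :: "ereal \<Rightarrow> ereal \<Rightarrow> ereal \<Rightarrow> ereal \<Rightarrow> (real \<times> real) set" where
  "dom_rect a1 a2 b1 b2 =
     {(x, t). a1 < ereal x \<and> ereal x < a2 \<and> b1 < ereal t \<and> ereal t < b2}"


text \<open>
  The matrix coupled dispersionless equations on \<open>\<Omega>\<close>; existence of the derivatives
  \<open>R\<^sub>x\<close>, \<open>V\<^sub>t\<close> and \<open>V\<^sub>t\<^sub>x\<close> (first in \<open>t\<close>, then in \<open>x\<close>) is part of being a solution.
\<close>

definition mcde ::
  "(real \<times> real) set \<Rightarrow> nat \<Rightarrow>
   (real \<Rightarrow> real \<Rightarrow> complex ^ 'm::finite ^ 'm) \<Rightarrow> (real \<Rightarrow> real \<Rightarrow> complex ^ 'm ^ 'm) \<Rightarrow> bool" where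
  "mcde \<Omega> p R V \<longleftrightarrow> (\<forall>(x, t) \<in> \<Omega>.
     (\<lambda>s. V x s) differentiable (at t) \<and>
     has_pd_x R (((-1) ^ p / 2) *\<^sub>R (V x t ** pd_t V x t + pd_t V x t ** V x t)) x t \<and>
     has_pd_x (pd_t V) ((1 / 2) *\<^sub>R (V x t ** R x t + R x t ** V x t)) x t)"

definition Gmat ::
  "nat \<Rightarrow> (real \<Rightarrow> real \<Rightarrow> complex ^ ('a::finite + 'b::finite) ^ ('a + 'b))
    \<Rightarrow> real \<Rightarrow> real \<Rightarrow> complex \<Rightarrow> complex ^ ('a + 'b) ^ ('a + 'b)" where
  "Gmat p V x t l = (\<i> / 4 * l) \<cdot>\<^sub>C jmat - (\<i> / 2) \<cdot>\<^sub>C (jpow (p + 1) ** V x t)"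

definition Fmat ::
  "nat \<Rightarrow> (real \<Rightarrow> real \<Rightarrow> complex ^ ('a::finite + 'b::finite) ^ ('a + 'b))
    \<Rightarrow> (real \<Rightarrow> real \<Rightarrow> complex ^ ('a + 'b) ^ ('a + 'b))
    \<Rightarrow> real \<Rightarrow> real \<Rightarrow> complex \<Rightarrow> complex ^ ('a + 'b) ^ ('a + 'b)" where
  "Fmat p R V x t l =
     (1 / l) \<cdot>\<^sub>C ((- \<i>) \<cdot>\<^sub>C (jmat ** R x t) + jpow p ** pd_t V x t)"

definition wave_function ::
  "(real \<times> real) set \<Rightarrow> nat
    \<Rightarrow> (real \<Rightarrow> real \<Rightarrow> complex ^ ('a::finite + 'b::finite) ^ ('a + 'b))
    \<Rightarrow> (real \<Rightarrow> real \<Rightarrow> complex ^ ('a + 'b) ^ ('a + 'b))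
    \<Rightarrow> complex \<Rightarrow> (real \<Rightarrow> real \<Rightarrow> complex ^ ('a + 'b) ^ ('a + 'b)) \<Rightarrow> bool" where
  "wave_function \<Omega> p R V l w \<longleftrightarrow>
     det (w 0 0) \<noteq> 0 \<and>
     (\<forall>(x, t) \<in> \<Omega>. has_pd_x w (Gmat p V x t l ** w x t) x t \<and>
                   has_pd_t w (Fmat p R V x t l ** w x t) x t)"


definition q1 :: "complex ^ ('a::finite + 'b::finite) ^ ('a + 'b)" where
  "q1 = (- \<i> / 4) \<cdot>\<^sub>C jmat"

definition q0 ::
  "nat \<Rightarrow> (real \<Rightarrow> real \<Rightarrow> complex ^ ('a::finite + 'b::finite) ^ ('a + 'b))
    \<Rightarrow> real \<Rightarrow> real \<Rightarrow> complex ^ ('a + 'b) ^ ('a + 'b)" where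
  "q0 p V x t = (\<i> / 2) \<cdot>\<^sub>C (jpow (p + 1) ** V x t)"

definition Qm1 ::
  "nat \<Rightarrow> (real \<Rightarrow> real \<Rightarrow> complex ^ ('a::finite + 'b::finite) ^ ('a + 'b))
    \<Rightarrow> (real \<Rightarrow> real \<Rightarrow> complex ^ ('a + 'b) ^ ('a + 'b))
    \<Rightarrow> real \<Rightarrow> real \<Rightarrow> complex ^ ('a + 'b) ^ ('a + 'b)" where
  "Qm1 p R V x t = \<i> \<cdot>\<^sub>C (jmat ** R x t) - jpow p ** pd_t V x t"

definition linear_systems ::
  "(real \<times> real) set \<Rightarrow> nat
    \<Rightarrow> (real \<Rightarrow> real \<Rightarrow> complex ^ ('a::finite + 'b::finite) ^ ('a + 'b))
    \<Rightarrow> (real \<Rightarrow> real \<Rightarrow> complex ^ ('a + 'b) ^ ('a + 'b))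
    \<Rightarrow> complex ^ 'n::finite ^ 'n \<Rightarrow> complex ^ 'n ^ 'n
    \<Rightarrow> (real \<Rightarrow> real \<Rightarrow> complex ^ ('a + 'b) ^ 'n)
    \<Rightarrow> (real \<Rightarrow> real \<Rightarrow> complex ^ ('a + 'b) ^ 'n)
    \<Rightarrow> (real \<Rightarrow> real \<Rightarrow> complex ^ 'n ^ 'n) \<Rightarrow> bool" where
  "linear_systems \<Omega> p R V A1 A2 P1 P2 S \<longleftrightarrow> (\<forall>(x, t) \<in> \<Omega>.
     has_pd_x P1 (P1 x t ** q0 p V x t + A1 ** P1 x t ** q1) x t \<and>
     has_pd_t P1 (matrix_inv A1 ** P1 x t ** Qm1 p R V x t) x t \<and>
     has_pd_x P2 (- (P2 x t ** adj (q0 p V x t)) - adj A2 ** P2 x t ** adj q1) x t \<and>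
     has_pd_t P2 (- (matrix_inv (adj A2) ** P2 x t ** adj (Qm1 p R V x t))) x t \<and>
     has_pd_x S (P1 x t ** q1 ** adj (P2 x t)) x t \<and>
     has_pd_t S (- (matrix_inv A1 ** P1 x t ** Qm1 p R V x t ** adj (P2 x t) ** matrix_inv A2)) x t)"


definition X0 ::
  "complex ^ 'm ^ 'n \<Rightarrow> complex ^ 'm ^ 'n \<Rightarrow> complex ^ 'n::finite ^ 'n \<Rightarrow> complex ^ 'm::finite ^ 'm" where
  "X0 P1 P2 S = adj P2 ** matrix_inv S ** P1"

definition Xm1 ::
  "complex ^ 'n ^ 'n \<Rightarrow> complex ^ 'm ^ 'n \<Rightarrow> complex ^ 'm ^ 'n \<Rightarrow> complex ^ 'n::finite ^ 'n
    \<Rightarrow> complex ^ 'm::finite ^ 'm" where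
  "Xm1 A1 P1 P2 S = adj P2 ** matrix_inv S ** matrix_inv A1 ** P1"

definition Ym1 ::
  "complex ^ 'n ^ 'n \<Rightarrow> complex ^ 'm ^ 'n \<Rightarrow> complex ^ 'm ^ 'n \<Rightarrow> complex ^ 'n::finite ^ 'n
    \<Rightarrow> complex ^ 'm::finite ^ 'm" where
  "Ym1 A2 P1 P2 S = adj P2 ** matrix_inv A2 ** matrix_inv S ** P1"

text \<open>
  At points where \<open>S\<close> is singular the following functions take irrelevant values
  (\<open>matrix_inv\<close> is then unspecified).
\<close>

definition Qm1_new ::
  "nat \<Rightarrow> (real \<Rightarrow> real \<Rightarrow> complex ^ ('a::finite + 'b::finite) ^ ('a + 'b))
    \<Rightarrow> (real \<Rightarrow> real \<Rightarrow> complex ^ ('a + 'b) ^ ('a + 'b))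
    \<Rightarrow> complex ^ 'n::finite ^ 'n \<Rightarrow> complex ^ 'n ^ 'n
    \<Rightarrow> (real \<Rightarrow> real \<Rightarrow> complex ^ ('a + 'b) ^ 'n)
    \<Rightarrow> (real \<Rightarrow> real \<Rightarrow> complex ^ ('a + 'b) ^ 'n)
    \<Rightarrow> (real \<Rightarrow> real \<Rightarrow> complex ^ 'n ^ 'n)
    \<Rightarrow> real \<Rightarrow> real \<Rightarrow> complex ^ ('a + 'b) ^ ('a + 'b)" where
  "Qm1_new p R V A1 A2 P1 P2 S x t =
     (mat 1 - Xm1 A1 (P1 x t) (P2 x t) (S x t)) ** Qm1 p R V x t
       ** (mat 1 + Ym1 A2 (P1 x t) (P2 x t) (S x t))"

definition V_new ::
  "nat \<Rightarrow> (real \<Rightarrow> real \<Rightarrow> complex ^ ('a::finite + 'b::finite) ^ ('a + 'b))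
    \<Rightarrow> (real \<Rightarrow> real \<Rightarrow> complex ^ ('a + 'b) ^ 'n::finite)
    \<Rightarrow> (real \<Rightarrow> real \<Rightarrow> complex ^ ('a + 'b) ^ 'n)
    \<Rightarrow> (real \<Rightarrow> real \<Rightarrow> complex ^ 'n ^ 'n)
    \<Rightarrow> real \<Rightarrow> real \<Rightarrow> complex ^ ('a + 'b) ^ ('a + 'b)" where
  "V_new p V P1 P2 S x t =
     (let X = X0 (P1 x t) (P2 x t) (S x t)
      in V x t + (1 / 2) *\<^sub>R (jpow p ** (X - jmat ** X ** jmat)))"

definition R_new ::
  "nat \<Rightarrow> (real \<Rightarrow> real \<Rightarrow> complex ^ ('a::finite + 'b::finite) ^ ('a + 'b))
    \<Rightarrow> (real \<Rightarrow> real \<Rightarrow> complex ^ ('a + 'b) ^ ('a + 'b))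
    \<Rightarrow> complex ^ 'n::finite ^ 'n \<Rightarrow> complex ^ 'n ^ 'n
    \<Rightarrow> (real \<Rightarrow> real \<Rightarrow> complex ^ ('a + 'b) ^ 'n)
    \<Rightarrow> (real \<Rightarrow> real \<Rightarrow> complex ^ ('a + 'b) ^ 'n)
    \<Rightarrow> (real \<Rightarrow> real \<Rightarrow> complex ^ 'n ^ 'n)
    \<Rightarrow> real \<Rightarrow> real \<Rightarrow> complex ^ ('a + 'b) ^ ('a + 'b)" where
  "R_new p R V A1 A2 P1 P2 S x t =
     (let Q = Qm1_new p R V A1 A2 P1 P2 S x t
      in (1 / (2 * \<i>)) \<cdot>\<^sub>C (Q ** jmat + jmat ** Q))"

definition darboux ::
  "complex ^ 'n::finite ^ 'n
    \<Rightarrow> (real \<Rightarrow> real \<Rightarrow> complex ^ 'm::finite ^ 'n) \<Rightarrow> (real \<Rightarrow> real \<Rightarrow> complex ^ 'm ^ 'n)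
    \<Rightarrow> (real \<Rightarrow> real \<Rightarrow> complex ^ 'n ^ 'n)
    \<Rightarrow> real \<Rightarrow> real \<Rightarrow> complex \<Rightarrow> complex ^ 'm ^ 'm" where
  "darboux A1 P1 P2 S x t l =
     mat 1 - adj (P2 x t) ** matrix_inv (S x t) ** matrix_inv (A1 - mat l) ** P1 x t"

end

theory Submission
  imports Defs
begin

text \<open>
  Write \<open>Q\<close> for the coefficient \<open>Qm1\<close>. For block diagonal \<open>R\<close> and block off-diagonal \<open>V\<close> the coupled
  dispersionless equations are equivalent to the pair of commutator identities
  \<open>(q0)\<^sub>t = [q1, Q]\<close> and \<open>Q\<^sub>x = [Q, q0]\<close>: the first one expresses that the off-diagonal part of \<open>Q\<close> is
  \<open>- j\<^sup>p V\<^sub>t\<close>, and the diagonal and off-diagonal parts of the second one are the two equations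
  (\<open>curvature_t_algebra\<close>, \<open>curvature_x_algebra\<close>). The whole argument runs on these identities, called
  zero curvature below.

  Zero curvature is the compatibility condition of every system
  \<open>Y\<^sub>x = Y q0 + A Y q1\<close>, \<open>Y\<^sub>t = A\<^sup>-\<^sup>1 Y Q\<close> with a constant invertible matrix \<open>A\<close>. The function \<open>\<Pi>\<^sub>1\<close> solves a
  system of this kind. The adjoint coefficients \<open>- q1\<^sup>*\<close>, \<open>- q0\<^sup>*\<close>, \<open>- Q\<^sup>*\<close> have zero curvature as well, and
  both \<open>\<Pi>\<^sub>2\<close> (with \<open>A = A2\<^sup>*\<close>) and the adjoint of a wave function (with \<open>A\<close> the scalar matrix of the
  conjugate of \<open>\<lambda>\<close>) solve the corresponding adjoint system. So a single theorem on compatible linear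
  systems, \<open>total_system_exists\<close>, yields all of them. Its solution is built by integrating first along the
  \<open>x\<close>-axis and then in the direction of \<open>t\<close>. The result \<open>w\<close> is a priori only continuous in \<open>x\<close>; that it
  satisfies the \<open>x\<close>-equation is seen by comparing it with the integral over \<open>[0, x]\<close> of the right side of that
  equation: the difference solves a homogeneous Volterra equation in \<open>t\<close> and vanishes. Finally \<open>S\<close> is a potential of a
  closed form in \<open>\<Pi>\<^sub>1\<close> and \<open>\<Pi>\<^sub>2\<close>.

  The Sylvester identity \<open>A1 S - S A2 = \<Pi>\<^sub>1 \<Pi>\<^sub>2\<^sup>*\<close> propagates from the origin to the
  whole domain, since both sides have the same partial derivatives. Where \<open>S\<close> is invertible, it turns the
  systems for \<open>\<Pi>\<^sub>1\<close>, \<open>\<Pi>\<^sub>2\<close>, \<open>S\<close> into systems for \<open>K = \<Pi>\<^sub>2\<^sup>* S\<^sup>-\<^sup>1\<close> and \<open>L = S\<^sup>-\<^sup>1 \<Pi>\<^sub>1\<close> that have the same form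
  as those of \<open>\<Pi>\<^sub>2\<^sup>*\<close> and \<open>\<Pi>\<^sub>1\<close>, but with \<open>A1\<close>, \<open>A2\<close> interchanged and \<open>q0\<close>, \<open>Q\<close> replaced by \<open>q0' = q0 - [q1, X0]\<close>, where \<open>X0 = K \<Pi>\<^sub>1\<close>,
  and by \<open>Q' = w\<^sub>A(0) Q w\<^sub>A(0)\<^sup>-\<^sup>1\<close>. Consequently \<open>(X0)\<^sub>t = Q - Q'\<close>, and the Darboux matrix intertwines the
  old and the new auxiliary systems:
  \<open>(w\<^sub>A)\<^sub>x = w\<^sub>A (q0 + \<lambda> q1) - (q0' + \<lambda> q1) w\<^sub>A\<close> and \<open>\<lambda> (w\<^sub>A)\<^sub>t = w\<^sub>A Q - Q' w\<^sub>A\<close>.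
  The formula for \<open>(X0)\<^sub>t\<close> gives \<open>(q0')\<^sub>t = [q1, Q']\<close>; the first intertwining relation at \<open>\<lambda> = 0\<close>, where \<open>w\<^sub>A\<close>
  conjugates \<open>Q\<close> into \<open>Q'\<close>, gives \<open>Q'\<^sub>x = [Q', q0']\<close>; and both relations for general \<open>\<lambda>\<close> say that
  \<open>w\<^sub>A w\<close> is a wave function. Zero curvature of \<open>q0'\<close>, \<open>Q'\<close>, read backwards
  through the block decomposition, is the statement that \<open>R_new\<close> and \<open>V_new\<close> solve the equations.
\<close>

section \<open>Integration from the origin\<close>

text \<open>
  The domain is a product of two such intervals. They contain the segment from \<open>0\<close> to each of their points,
  along which all equations are integrated.
\<close>

definition interval_at_0 :: "real set \<Rightarrow> bool" where
  "interval_at_0 J \<longleftrightarrow> open J \<and> convex J \<and> 0 \<in> J"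

lemma interval_at_0_scale:
  assumes "interval_at_0 J" "t \<in> J" "\<theta> \<in> {0..1}"
  shows "\<theta> * t \<in> J"
proof -
  have "(1 - \<theta>) *\<^sub>R 0 + \<theta> *\<^sub>R t \<in> J"
    using assms unfolding interval_at_0_def by (intro convexD) auto
  then show ?thesis by simp
qed

text \<open>
  One step of a Picard type iteration for norms. Parametrizing by \<open>s = \<theta> t\<close> with \<open>\<theta>\<close> in the unit interval
  treats both signs of \<open>t\<close> at once, and the bound is the mean value inequality against
  \<open>b |t|\<^sup>n\<^sup>+\<^sup>1 \<theta>\<^sup>n\<^sup>+\<^sup>1 / (n + 1)\<close>.
\<close>

lemma norm_le_power_from_derivative:
  fixes f :: "real \<Rightarrow> 'e::real_normed_vector"
  assumes J: "interval_at_0 J" and t: "t \<in> J"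
    and deriv: "\<And>s. s \<in> J \<Longrightarrow> (f has_vector_derivative f' s) (at s)"
    and bound: "\<And>\<theta>. \<theta> \<in> {0..1} \<Longrightarrow> norm (f' (\<theta> * t)) \<le> b * \<bar>\<theta> * t\<bar> ^ n"
    and "f 0 = 0"
  shows "norm (f t) \<le> b * \<bar>t\<bar> ^ Suc n / real (Suc n)"
proof -
  define \<phi> where "\<phi> = (\<lambda>\<theta>::real. b * \<bar>t\<bar> ^ Suc n * \<theta> ^ Suc n / real (Suc n))"
  have d1: "((\<lambda>\<theta>. f (\<theta> * t)) has_vector_derivative t *\<^sub>R f' (\<theta> * t)) (at \<theta>)" if "\<theta> \<in> {0..1}" for \<theta>
  proof -
    have "((\<lambda>\<theta>::real. \<theta> * t) has_vector_derivative t) (at \<theta>)"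
      by (auto intro!: derivative_eq_intros)
    from vector_diff_chain_at[OF this deriv[OF interval_at_0_scale[OF J t that]]]
    show ?thesis by (simp add: o_def)
  qed
  have d2: "(\<phi> has_vector_derivative b * \<bar>t\<bar> ^ Suc n * \<theta> ^ n) (at \<theta>)" for \<theta>
  proof -
    have "(\<phi> has_field_derivative b * \<bar>t\<bar> ^ Suc n * \<theta> ^ n) (at \<theta>)"
      unfolding \<phi>_def by (rule derivative_eq_intros refl | simp)+
    then show ?thesis by (simp add: has_real_derivative_iff_has_vector_derivative)
  qed
  have "norm (f (1 * t) - f (0 * t)) \<le> \<phi> 1 - \<phi> 0"
  proof (rule differentiable_bound_general[where f = "\<lambda>\<theta>. f (\<theta> * t)"])
    show "continuous_on {0..1} (\<lambda>\<theta>. f (\<theta> * t))"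
      using d1 by (meson continuous_at_imp_continuous_on has_vector_derivative_continuous)
    show "continuous_on {0..1} \<phi>"
      using d2 by (meson continuous_at_imp_continuous_on has_vector_derivative_continuous)
    show "norm (t *\<^sub>R f' (\<theta> * t)) \<le> b * \<bar>t\<bar> ^ Suc n * \<theta> ^ n" if "0 < \<theta>" "\<theta> < 1" for \<theta>
    proof -
      have "norm (t *\<^sub>R f' (\<theta> * t)) \<le> \<bar>t\<bar> * (b * \<bar>\<theta> * t\<bar> ^ n)"
        using that by (auto intro!: mult_left_mono bound)
      also have "\<dots> = b * \<bar>t\<bar> ^ Suc n * \<theta> ^ n"
        using that by (simp add: abs_mult power_mult_distrib)
      finally show ?thesis .
    qed
  qed (use d1 d2 in auto)
  then show ?thesis using \<open>f 0 = 0\<close> by (simp add: \<phi>_def)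
qed

lemma compact_subinterval:
  assumes J: "interval_at_0 J" and t: "t \<in> J"
  obtains c d where "c < 0" "c < t" "0 < d" "t < d" "{c..d} \<subseteq> J"
proof -
  have "open J" using J by (simp add: interval_at_0_def)
  moreover have "min 0 t \<in> J" "max 0 t \<in> J" using J t by (auto simp: interval_at_0_def min_def max_def)
  ultimately obtain e1 e2 where e: "e1 > 0" "cball (min 0 t) e1 \<subseteq> J" "e2 > 0" "cball (max 0 t) e2 \<subseteq> J"
    by (meson open_contains_cball)
  define c d where "c = min 0 t - e1" and "d = max 0 t + e2"
  have cd: "c < 0" "c < t" "0 < d" "t < d" using e by (auto simp: c_def d_def)
  have "c \<in> J" using e by (intro subsetD[OF e(2)]) (auto simp: c_def dist_norm)
  moreover have "d \<in> J" using e by (intro subsetD[OF e(4)]) (auto simp: d_def dist_norm)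
  ultimately have "{c..d} \<subseteq> J"
    using J by (metis interval_at_0_def closed_segment_eq_real_ivl closed_segment_subset cd less_trans less_imp_le)
  with cd that show ?thesis by blast
qed

text \<open>
  The oriented integral of \<open>f\<close> from \<open>0\<close> to \<open>t\<close>. Rescaling it to the fixed unit interval avoids a case
  distinction on the sign of \<open>t\<close> and makes the theorems on integrals with parameters applicable to \<open>t\<close> itself.
\<close>

definition primitive :: "(real \<Rightarrow> 'e::banach) \<Rightarrow> real \<Rightarrow> 'e" where
  "primitive f t = t *\<^sub>R integral {0..1} (\<lambda>\<theta>. f (\<theta> * t))"

lemma primitive_0 [simp]: "primitive f 0 = 0"
  by (simp add: primitive_def)

lemma primitive_eq_diff:
  assumes J: "interval_at_0 J" and t: "t \<in> J"
    and deriv: "\<And>\<theta>. \<theta> \<in> {0..1} \<Longrightarrow> (F has_vector_derivative f (\<theta> * t)) (at (\<theta> * t))"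
  shows "primitive f t = F t - F 0"
proof -
  have d1: "((\<lambda>\<theta>. F (\<theta> * t)) has_vector_derivative t *\<^sub>R f (\<theta> * t)) (at \<theta>)" if "\<theta> \<in> {0..1}" for \<theta>
  proof -
    have "((\<lambda>\<theta>::real. \<theta> * t) has_vector_derivative t) (at \<theta>)"
      by (auto intro!: derivative_eq_intros)
    from vector_diff_chain_at[OF this deriv[OF that]]
    show ?thesis by (simp add: o_def)
  qed
  have "((\<lambda>\<theta>. t *\<^sub>R f (\<theta> * t)) has_integral (F (1 * t) - F (0 * t))) {0..1}"
    by (rule fundamental_theorem_of_calculus) (use d1 in \<open>auto intro: has_vector_derivative_at_within\<close>)
  then have "integral {0..1} (\<lambda>\<theta>. t *\<^sub>R f (\<theta> * t)) = F (1 * t) - F (0 * t)"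
    by (rule integral_unique)
  then show ?thesis by (simp add: primitive_def)
qed

lemma has_vector_derivative_primitive:
  assumes J: "interval_at_0 J" and t: "t \<in> J" and f: "continuous_on J f"
  shows "(primitive f has_vector_derivative f t) (at t)"
proof -
  obtain c d where cd: "c < 0" "c < t" "0 < d" "t < d" and sub: "{c..d} \<subseteq> J"
    using compact_subinterval[OF J t] .
  define F where "F = (\<lambda>u. integral {c..u} f)"
  have F: "(F has_vector_derivative f s) (at s)" if "s \<in> {c<..<d}" for s
  proof -
    have "(F has_vector_derivative f s) (at s within {c..d})"
      unfolding F_def by (rule integral_has_vector_derivative) (use that f sub in \<open>auto intro: continuous_on_subset\<close>)
    moreover have "at s within {c..d} = at s"
      using that by (intro at_within_interior) auto
    ultimately show ?thesis by simp
  qed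
  have cd0: "interval_at_0 {c<..<d}" using cd by (auto simp: interval_at_0_def)
  have eq: "F s - F 0 = primitive f s" if "s \<in> {c<..<d}" for s
    using primitive_eq_diff[OF cd0 that F] interval_at_0_scale[OF cd0 that] by auto
  have "((\<lambda>s. F s - F 0) has_vector_derivative f t) (at t)"
    using F cd by (auto intro!: derivative_eq_intros)
  then show ?thesis
    by (rule has_vector_derivative_transform_within_open[where S = "{c<..<d}"]) (use cd eq in auto)
qed

lemma continuous_on_primitive:
  fixes f :: "'p::topological_space \<Rightarrow> real \<Rightarrow> 'e::banach"
  assumes J: "\<And>t \<theta>. t \<in> J \<Longrightarrow> \<theta> \<in> {0..1} \<Longrightarrow> \<theta> * t \<in> J" and f: "continuous_on (P \<times> J) (\<lambda>(p, t). f p t)"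
  shows "continuous_on (P \<times> J) (\<lambda>(p, t). primitive (f p) t)"
proof -
  have "continuous_on (P \<times> J) (\<lambda>z. integral (cbox 0 1) (\<lambda>\<theta>::real. f (fst z) (\<theta> * snd z)))"
  proof (rule integral_continuous_on_param)
    have "continuous_on ((P \<times> J) \<times> cbox 0 1) (\<lambda>w. case (fst (fst w), snd w * snd (fst w)) of (p, t) \<Rightarrow> f p t)"
      by (rule continuous_on_compose2[OF f]) (auto intro!: continuous_intros J)
    then show "continuous_on ((P \<times> J) \<times> cbox 0 1) (\<lambda>(z, \<theta>::real). f (fst z) (\<theta> * snd z))"
      by (simp add: case_prod_unfold)
  qed
  then show ?thesis
    by (auto simp: primitive_def case_prod_unfold intro!: continuous_intros)
qed

lemma has_vector_derivative_primitive_param: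
  fixes f :: "real \<Rightarrow> real \<Rightarrow> 'e::banach"
  assumes I: "interval_at_0 I" and J: "interval_at_0 J" and t: "t \<in> J" and x: "x \<in> I"
    and deriv: "\<And>x t. x \<in> I \<Longrightarrow> t \<in> J \<Longrightarrow> ((\<lambda>t. f x t) has_vector_derivative f' x t) (at t)"
    and cont: "continuous_on (I \<times> J) (\<lambda>(x, t). f x t)" "continuous_on (I \<times> J) (\<lambda>(x, t). f' x t)"
  shows "((\<lambda>t. primitive (\<lambda>x. f x t) x) has_vector_derivative primitive (\<lambda>x. f' x t) x) (at t)"
proof -
  have sc: "\<theta> * x \<in> I" if "\<theta> \<in> {0..1}" for \<theta> using interval_at_0_scale[OF I x that] .
  have "((\<lambda>t. integral (cbox 0 1) (\<lambda>\<theta>::real. f (\<theta> * x) t)) has_vector_derivative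
      integral (cbox 0 1) (\<lambda>\<theta>. f' (\<theta> * x) t)) (at t within J)"
  proof (rule leibniz_rule_vector_derivative)
    show "convex J" "t \<in> J" using J t by (auto simp: interval_at_0_def)
    show "((\<lambda>t. f (\<theta> * x) t) has_vector_derivative f' (\<theta> * x) s) (at s within J)"
      if "s \<in> J" "\<theta> \<in> cbox 0 1" for s \<theta>
      using deriv sc that by (auto intro: has_vector_derivative_at_within)
    show "(\<lambda>\<theta>. f (\<theta> * x) s) integrable_on cbox 0 1" if "s \<in> J" for s
    proof (rule integrable_continuous)
      have "continuous_on (cbox 0 1) (\<lambda>\<theta>. case (\<theta> * x, s) of (x, t) \<Rightarrow> f x t)"
        by (rule continuous_on_compose2[OF cont(1)]) (auto intro!: continuous_intros sc that)
      then show "continuous_on (cbox 0 1) (\<lambda>\<theta>. f (\<theta> * x) s)" by simp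
    qed
    have "continuous_on (J \<times> cbox 0 1) (\<lambda>w. case (snd w * x, fst w) of (x, t) \<Rightarrow> f' x t)"
      by (rule continuous_on_compose2[OF cont(2)]) (auto intro!: continuous_intros sc)
    then show "continuous_on (J \<times> cbox 0 1) (\<lambda>(s, \<theta>). f' (\<theta> * x) s)"
      by (simp add: case_prod_unfold)
  qed
  then have "((\<lambda>t. integral (cbox 0 1) (\<lambda>\<theta>::real. f (\<theta> * x) t)) has_vector_derivative
      integral (cbox 0 1) (\<lambda>\<theta>. f' (\<theta> * x) t)) (at t)"
    using J t by (simp add: interval_at_0_def at_within_open[of t J])
  from bounded_linear.has_vector_derivative[OF bounded_linear_scaleR_right[of x] this]
  show ?thesis unfolding primitive_def by simp
qed

text \<open>
  The hypothesis \<open>step\<close> is what a linear differential or Volterra equation with zero initial value implies.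
  Iterating it from the constant bound gives \<open>M (C |t|)\<^sup>n / n!\<close> for every \<open>n\<close>, which tends to zero. The index
  \<open>p\<close> admits equations that couple the values at different parameters.
\<close>

lemma volterra_zero:
  fixes d :: "'p \<Rightarrow> real \<Rightarrow> 'e::real_normed_vector"
  assumes bounded: "\<And>p t. p \<in> P \<Longrightarrow> t \<in> K \<Longrightarrow> norm (d p t) \<le> M"
    and step: "\<And>b n. (\<And>p t. p \<in> P \<Longrightarrow> t \<in> K \<Longrightarrow> norm (d p t) \<le> b * \<bar>t\<bar> ^ n) \<Longrightarrow>
      (\<And>p t. p \<in> P \<Longrightarrow> t \<in> K \<Longrightarrow> norm (d p t) \<le> C * b * \<bar>t\<bar> ^ Suc n / real (Suc n))"
    and "p \<in> P" "t \<in> K"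
  shows "d p t = 0"
proof -
  have iter: "norm (d p t) \<le> M * C ^ n / fact n * \<bar>t\<bar> ^ n" if "p \<in> P" "t \<in> K" for n p t
    using that
  proof (induction n arbitrary: p t)
    case 0 then show ?case using bounded by simp
  next
    case (Suc n)
    show ?case using step[OF Suc.IH Suc.prems] by (simp add: field_simps)
  qed
  have "(\<lambda>n. (C * \<bar>t\<bar>) ^ n /\<^sub>R fact n) sums exp (C * \<bar>t\<bar>)"
    by (rule exp_converges)
  then have "(\<lambda>n. (C * \<bar>t\<bar>) ^ n /\<^sub>R fact n) \<longlonglongrightarrow> 0"
    by (rule summable_LIMSEQ_zero[OF sums_summable])
  then have "(\<lambda>n. M * ((C * \<bar>t\<bar>) ^ n /\<^sub>R fact n)) \<longlonglongrightarrow> M * 0"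
    by (rule tendsto_mult_left)
  then have "norm (d p t) \<le> M * 0"
    by (rule LIMSEQ_le_const)
      (use iter[OF assms(3,4)] in \<open>auto simp: power_mult_distrib field_simps\<close>)
  then show ?thesis by simp
qed

section \<open>Linear differential equations with a parameter\<close>

lemma compact_bounded_image:
  fixes f :: "'a::topological_space \<Rightarrow> 'b::real_normed_vector"
  assumes "compact K" "continuous_on K f"
  obtains C where "C \<ge> 0" "\<And>x. x \<in> K \<Longrightarrow> norm (f x) \<le> C"
proof -
  have "bounded (f ` K)" using assms by (intro compact_imp_bounded compact_continuous_image)
  then obtain C where "C > 0" "\<And>y. y \<in> f ` K \<Longrightarrow> norm y \<le> C" using bounded_pos by metis
  then show ?thesis using that[of C] by auto
qed

text \<open>
  Picard iteration, carried out with the parameter \<open>p\<close> present all along, because joint continuity of the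
  solution in \<open>(p, t)\<close> is needed later. The increments \<open>u n\<close> are bounded by \<open>B (C |t|)\<^sup>n / n!\<close> on products of
  compact sets, so their sum converges locally uniformly.
\<close>

lemma linear_ode_exists:
  fixes L :: "'p::{metric_space,heine_borel} \<Rightarrow> real \<Rightarrow> ('e::banach \<Rightarrow>\<^sub>L 'e)"
  assumes J: "interval_at_0 J" and P: "open P"
    and L: "continuous_on (P \<times> J) (\<lambda>(p, t). L p t)" and g: "continuous_on P g"
  obtains y where "continuous_on (P \<times> J) (\<lambda>(p, t). y p t)" "\<And>p. p \<in> P \<Longrightarrow> y p 0 = g p"
    "\<And>p t. p \<in> P \<Longrightarrow> t \<in> J \<Longrightarrow> ((\<lambda>t. y p t) has_vector_derivative L p t (y p t)) (at t)"
proof -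
  note sc = interval_at_0_scale[OF J]
  define u where "u n = ((\<lambda>v p. primitive (\<lambda>t. L p t (v p t))) ^^ n) (\<lambda>p t. g p)" for n
  have u0: "u 0 = (\<lambda>p t. g p)" and uS: "u (Suc n) p = primitive (\<lambda>t. L p t (u n p t))" for n p
    by (auto simp: u_def)
  have sect: "continuous_on J (h p)" if "continuous_on (P \<times> J) (\<lambda>(p, t). h p t)" "p \<in> P"
    for h :: "'p \<Rightarrow> real \<Rightarrow> 'e" and p
  proof -
    have "continuous_on J (\<lambda>t. case (p, t) of (p, t) \<Rightarrow> h p t)"
      by (rule continuous_on_compose2[OF that(1)]) (use that in \<open>auto intro!: continuous_intros\<close>)
    then show ?thesis by simp
  qed
  have Lcont: "continuous_on (P \<times> J) (\<lambda>(p, t). L p t (h p t))"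
    if "continuous_on (P \<times> J) (\<lambda>(p, t). h p t)" for h
    using L that by (auto simp: case_prod_unfold intro!: continuous_intros)
  have ucont: "continuous_on (P \<times> J) (\<lambda>(p, t). u n p t)" for n
  proof (induction n)
    case 0
    have "continuous_on (P \<times> J) (\<lambda>z. g (fst z))"
      by (rule continuous_on_compose2[OF g]) (auto intro!: continuous_intros)
    then show ?case by (simp add: u0 case_prod_unfold)
  next
    case (Suc n)
    show ?case unfolding uS by (rule continuous_on_primitive[OF sc Lcont[OF Suc]])
  qed
  have uder: "(u (Suc n) p has_vector_derivative L p t (u n p t)) (at t)" if "p \<in> P" "t \<in> J" for n p t
    unfolding uS by (rule has_vector_derivative_primitive[OF J that(2) sect[OF Lcont[OF ucont] that(1)]])
  define s where "s N p t = (\<Sum>n<N. u n p t)" for N p t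
  define y where "y p t = (\<Sum>n. u n p t)" for p t
  have unif: "uniform_limit (K \<times> {c..d}) (\<lambda>N (p, t). s N p t) (\<lambda>(p, t). y p t) sequentially"
    if K: "compact K" "K \<subseteq> P" and cd: "c < 0" "0 < d" "{c..d} \<subseteq> J" for K c d
  proof -
    have sub: "K \<times> {c..d} \<subseteq> P \<times> J" using K cd by auto
    have comp: "compact (K \<times> {c..d})" using K by (intro compact_Times) auto
    obtain C where C: "C \<ge> 0" "\<And>z. z \<in> K \<times> {c..d} \<Longrightarrow> norm (case z of (p, t) \<Rightarrow> L p t) \<le> C"
      using compact_bounded_image[OF comp continuous_on_subset[OF L sub]] by blast
    obtain B where B: "B \<ge> 0" "\<And>p. p \<in> K \<Longrightarrow> norm (g p) \<le> B"
      using compact_bounded_image[OF K(1) continuous_on_subset[OF g K(2)]] by blast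
    have ub: "norm (u n p t) \<le> B * C ^ n / fact n * \<bar>t\<bar> ^ n" if "p \<in> K" "t \<in> {c..d}" for n p t
      using that
    proof (induction n arbitrary: p t)
      case 0 then show ?case using B by (simp add: u0)
    next
      case (Suc n)
      have "norm (u (Suc n) p t) \<le> C * (B * C ^ n / fact n) * \<bar>t\<bar> ^ Suc n / real (Suc n)"
      proof (rule norm_le_power_from_derivative[OF J])
        show "t \<in> J" using Suc cd by auto
        show "(u (Suc n) p has_vector_derivative L p s (u n p s)) (at s)" if "s \<in> J" for s
          using uder that Suc K by auto
        show "u (Suc n) p 0 = 0" by (simp add: uS)
        show "norm (L p (\<theta> * t) (u n p (\<theta> * t))) \<le> C * (B * C ^ n / fact n) * \<bar>\<theta> * t\<bar> ^ n"
          if "\<theta> \<in> {0..1}" for \<theta>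
        proof -
          have *: "\<theta> * t \<in> {c..d}"
          proof -
            have "\<theta> *\<^sub>R t + (1 - \<theta>) *\<^sub>R 0 \<in> {c..d}"
              using Suc that cd by (intro convexD) auto
            then show ?thesis by simp
          qed
          have "norm (L p (\<theta> * t) (u n p (\<theta> * t))) \<le> norm (L p (\<theta> * t)) * norm (u n p (\<theta> * t))"
            by (rule norm_blinfun)
          also have "\<dots> \<le> C * (B * C ^ n / fact n * \<bar>\<theta> * t\<bar> ^ n)"
            using C(2)[of "(p, \<theta> * t)"] Suc.IH[OF Suc.prems(1) *] * Suc.prems C(1)
            by (intro mult_mono) auto
          finally show ?thesis by (simp add: mult_ac)
        qed
      qed
      then show ?case by (simp add: field_simps)
    qed
    define T where "T = max (- c) d"
    have "uniform_limit (K \<times> {c..d}) (\<lambda>N z. \<Sum>n<N. case z of (p, t) \<Rightarrow> u n p t)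
        (\<lambda>z. \<Sum>n. case z of (p, t) \<Rightarrow> u n p t) sequentially"
    proof (rule Weierstrass_m_test)
      show "norm (case z of (p, t) \<Rightarrow> u n p t) \<le> B * ((C * T) ^ n /\<^sub>R fact n)" if z: "z \<in> K \<times> {c..d}" for n z
      proof -
        obtain p t where z': "z = (p, t)" "p \<in> K" "t \<in> {c..d}" using z by auto
        have "\<bar>t\<bar> \<le> T" using z' by (auto simp: T_def)
        then have "\<bar>t\<bar> ^ n \<le> T ^ n" by (intro power_mono) auto
        then have "B * C ^ n / fact n * \<bar>t\<bar> ^ n \<le> B * C ^ n / fact n * T ^ n"
          using B C by (intro mult_left_mono) auto
        then show ?thesis using ub[OF z'(2,3), of n] z'
          by (simp add: power_mult_distrib field_simps)
      qed
      show "summable (\<lambda>n. B * ((C * T) ^ n /\<^sub>R fact n))"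
        by (intro summable_mult summable_exp_generic)
    qed
    then show ?thesis by (simp add: s_def y_def case_prod_unfold)
  qed
  have ycont: "continuous_on (P \<times> J) (\<lambda>(p, t). y p t)"
  proof (rule continuous_at_imp_continuous_on, safe)
    fix p t assume pt: "p \<in> P" "t \<in> J"
    obtain c d where cd: "c < 0" "c < t" "0 < d" "t < d" "{c..d} \<subseteq> J" using compact_subinterval[OF J pt(2)] .
    obtain e where e: "e > 0" "cball p e \<subseteq> P" using P pt open_contains_cball by blast
    have "continuous_on (cball p e \<times> {c..d}) (\<lambda>(p, t). y p t)"
    proof (rule uniform_limit_theorem[OF _ unif])
      show "\<forall>\<^sub>F N in sequentially. continuous_on (cball p e \<times> {c..d}) (\<lambda>(p, t). s N p t)"
      proof (intro always_eventually allI)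
        fix N
        have "continuous_on (P \<times> J) (\<lambda>z. \<Sum>n<N. case z of (p, t) \<Rightarrow> u n p t)"
          by (intro continuous_on_sum ucont)
        then have "continuous_on (P \<times> J) (\<lambda>(p, t). s N p t)"
          by (simp add: s_def case_prod_unfold)
        then show "continuous_on (cball p e \<times> {c..d}) (\<lambda>(p, t). s N p t)"
          by (rule continuous_on_subset) (use e cd in auto)
      qed
    qed (use e cd in auto)
    moreover have "p \<in> interior (cball p e)" by (rule interiorI[of "ball p e"]) (use e in auto)
    then have "(p, t) \<in> interior (cball p e \<times> {c..d})"
      using cd by (simp add: interior_Times)
    ultimately show "isCont (\<lambda>(p, t). y p t) (p, t)"
      by (rule continuous_on_interior)
  qed
  have yeq: "y p t = g p + primitive (\<lambda>s. L p s (y p s)) t" if pt: "p \<in> P" "t \<in> J" for p t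
  proof -
    obtain c d where cd: "c < 0" "c < t" "0 < d" "t < d" "{c..d} \<subseteq> J" using compact_subinterval[OF J pt(2)] .
    have lim: "uniform_limit ({p} \<times> {c..d}) (\<lambda>N (p, t). s N p t) (\<lambda>(p, t). y p t) sequentially"
      using pt cd by (intro unif) auto
    have "continuous_on {c..d} (L p)"
    proof -
      have "continuous_on {c..d} (\<lambda>t. case (p, t) of (p, t) \<Rightarrow> L p t)"
        by (rule continuous_on_compose2[OF L]) (use pt cd in \<open>auto intro!: continuous_intros\<close>)
      then show ?thesis by simp
    qed
    then obtain C where C: "C \<ge> 0" "\<And>s. s \<in> {c..d} \<Longrightarrow> norm (L p s) \<le> C"
      using compact_bounded_image[OF compact_Icc] by metis
    have l1: "(\<lambda>N. s N p t) \<longlonglongrightarrow> y p t"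
      using tendsto_uniform_limitI[OF lim, of "(p, t)"] cd by auto
    define G where "G t = g p + primitive (\<lambda>s. L p s (y p s)) t" for t
    \<comment> \<open>The partial sum \<open>s (Suc N)\<close> has derivative \<open>L (s N)\<close> and \<open>G\<close> has derivative \<open>L y\<close>; so uniform
      convergence of \<open>s N\<close> to \<open>y\<close> controls their difference.\<close>
    have "(\<lambda>N. s (Suc N) p t) \<longlonglongrightarrow> G t"
    proof (rule LIMSEQ_I)
      fix r :: real assume "r > 0"
      \<comment> \<open>The summand 1 keeps the denominator positive and the final inequality strict.\<close>
      define \<epsilon> where "\<epsilon> = r / (C * \<bar>t\<bar> + 1)"
      have \<epsilon>: "\<epsilon> > 0" using \<open>r > 0\<close> C by (simp add: \<epsilon>_def add_nonneg_pos)
      obtain N0 where N0: "\<And>N s'. N \<ge> N0 \<Longrightarrow> s' \<in> {c..d} \<Longrightarrow> dist (s N p s') (y p s') < \<epsilon>"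
        using uniform_limitD[OF lim \<epsilon>] by (fastforce simp: eventually_sequentially)
      have "norm (s (Suc N) p t - G t) < r" if N: "N \<ge> N0" for N
      proof -
        have "norm (s (Suc N) p t - G t) \<le> C * \<epsilon> * \<bar>t\<bar> ^ Suc 0 / real (Suc 0)"
        proof (rule norm_le_power_from_derivative[OF J pt(2), where f = "\<lambda>t. s (Suc N) p t - G t"])
          show "((\<lambda>t. s (Suc N) p t - G t) has_vector_derivative L p s' (s N p s') - L p s' (y p s')) (at s')"
            if "s' \<in> J" for s'
          proof (rule has_vector_derivative_diff)
            have "((\<lambda>t. \<Sum>n<N. u (Suc n) p t) has_vector_derivative (\<Sum>n<N. L p s' (u n p s'))) (at s')"
              by (intro has_vector_derivative_sum uder pt that)
            then have "((\<lambda>t. g p + (\<Sum>n<N. u (Suc n) p t)) has_vector_derivative 0 + (\<Sum>n<N. L p s' (u n p s'))) (at s')"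
              by (intro has_vector_derivative_add has_vector_derivative_const)
            then show "(s (Suc N) p has_vector_derivative L p s' (s N p s')) (at s')"
              by (simp add: s_def[abs_def] u0 blinfun.sum_right sum.lessThan_Suc_shift del: sum.lessThan_Suc)
            have "((\<lambda>t. g p + primitive (\<lambda>s. L p s (y p s)) t) has_vector_derivative 0 + L p s' (y p s')) (at s')"
              by (intro has_vector_derivative_add has_vector_derivative_const
                 has_vector_derivative_primitive[OF J that] sect[OF Lcont[OF ycont]] pt)
            then show "(G has_vector_derivative L p s' (y p s')) (at s')" by (simp add: G_def[abs_def])
          qed
          show "s (Suc N) p 0 - G 0 = 0"
            by (simp add: s_def G_def uS u0 sum.lessThan_Suc_shift del: sum.lessThan_Suc)
          show "norm (L p (\<theta> * t) (s N p (\<theta> * t)) - L p (\<theta> * t) (y p (\<theta> * t))) \<le> C * \<epsilon> * \<bar>\<theta> * t\<bar> ^ 0"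
            if "\<theta> \<in> {0..1}" for \<theta>
          proof -
            have "\<theta> *\<^sub>R t + (1 - \<theta>) *\<^sub>R 0 \<in> {c..d}"
              using that cd by (intro convexD) auto
            then have *: "\<theta> * t \<in> {c..d}" by simp
            have "norm (L p (\<theta> * t) (s N p (\<theta> * t) - y p (\<theta> * t))) \<le> norm (L p (\<theta> * t)) * norm (s N p (\<theta> * t) - y p (\<theta> * t))"
              by (rule norm_blinfun)
            also have "\<dots> \<le> C * \<epsilon>"
              using C(2)[OF *] N0[OF N *] C(1) by (intro mult_mono) (auto simp: dist_norm)
            finally show ?thesis by (simp add: blinfun.diff_right)
          qed
        qed
        also have "\<dots> = r * (C * \<bar>t\<bar> / (C * \<bar>t\<bar> + 1))" by (simp add: \<epsilon>_def)
        also have "\<dots> < r * 1"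
          using \<open>r > 0\<close> C(1) by (intro mult_strict_left_mono) (simp_all add: divide_less_eq add_nonneg_pos)
        finally show ?thesis by simp
      qed
      then show "\<exists>no. \<forall>n\<ge>no. norm (s (Suc n) p t - G t) < r" by blast
    qed
    with LIMSEQ_Suc[OF l1] have "y p t = G t" by (rule LIMSEQ_unique)
    then show ?thesis by (simp add: G_def)
  qed
  have yder: "((\<lambda>t. y p t) has_vector_derivative L p t (y p t)) (at t)" if pt: "p \<in> P" "t \<in> J" for p t
  proof (rule has_vector_derivative_transform_within_open)
    have "((\<lambda>t. g p + primitive (\<lambda>s. L p s (y p s)) t) has_vector_derivative 0 + L p t (y p t)) (at t)"
      by (intro has_vector_derivative_add has_vector_derivative_const
         has_vector_derivative_primitive[OF J] sect[OF Lcont[OF ycont]] pt)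
    then show "((\<lambda>t. g p + primitive (\<lambda>s. L p s (y p s)) t) has_vector_derivative L p t (y p t)) (at t)" by simp
    show "open J" using J by (simp add: interval_at_0_def)
  qed (use pt yeq in auto)
  have "y p 0 = g p" if "p \<in> P" for p
    using yeq[OF that, of 0] J by (simp add: interval_at_0_def)
  from that[OF ycont this yder] show ?thesis .
qed

section \<open>Compatible pairs of linear equations\<close>

lemma continuous_on_swap:
  assumes "continuous_on (I \<times> J) (\<lambda>(x, t). f x t)"
  shows "continuous_on (J \<times> I) (\<lambda>(t, x). f x t)"
proof -
  have "continuous_on (J \<times> I) (\<lambda>w. case (snd w, fst w) of (x, t) \<Rightarrow> f x t)"
    by (rule continuous_on_compose2[OF assms]) (auto intro!: continuous_intros)
  then show ?thesis by (simp add: case_prod_unfold)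
qed

lemma continuous_on_section:
  assumes "continuous_on (I \<times> J) (\<lambda>(x, t). f x t)" "x \<in> I"
  shows "continuous_on J (f x)"
proof -
  have "continuous_on J (\<lambda>t. case (x, t) of (x, t) \<Rightarrow> f x t)"
    by (rule continuous_on_compose2[OF assms(1)]) (use assms in \<open>auto intro!: continuous_intros\<close>)
  then show ?thesis by simp
qed

lemma segment_scale:
  fixes r s \<theta> :: real
  assumes "s \<in> closed_segment 0 r" "\<theta> \<in> {0..1}"
  shows "\<theta> * s \<in> closed_segment 0 r"
proof -
  have "(1 - \<theta>) *\<^sub>R 0 + \<theta> *\<^sub>R s \<in> closed_segment 0 r"
    using assms by (intro convexD[OF convex_closed_segment]) auto
  then show ?thesis by simp
qed

lemma segment_subset_interval_at_0:
  assumes "interval_at_0 J" "t \<in> J"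
  shows "closed_segment 0 t \<subseteq> J"
  using assms by (intro closed_segment_subset) (auto simp: interval_at_0_def)

lemma linear_ode_zero:
  fixes y :: "real \<Rightarrow> 'e::banach"
  assumes J: "interval_at_0 J" and L: "continuous_on J L" and "y 0 = 0"
    and der: "\<And>t. t \<in> J \<Longrightarrow> (y has_vector_derivative blinfun_apply (L t) (y t)) (at t)"
    and t: "t \<in> J"
  shows "y t = 0"
proof -
  let ?K = "closed_segment 0 t"
  have K: "?K \<subseteq> J" by (rule segment_subset_interval_at_0[OF J t])
  have ycont: "continuous_on J y" using der
    by (meson continuous_at_imp_continuous_on has_vector_derivative_continuous)
  obtain C where C: "C \<ge> 0" "\<And>s. s \<in> ?K \<Longrightarrow> norm (L s) \<le> C"
    using compact_bounded_image[OF compact_segment continuous_on_subset[OF L K]] by metis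
  obtain M where M: "\<And>s. s \<in> ?K \<Longrightarrow> norm (y s) \<le> M"
    using compact_bounded_image[OF compact_segment continuous_on_subset[OF ycont K]] by metis
  show ?thesis
  proof (rule volterra_zero[where P = UNIV and K = ?K and d = "\<lambda>p::unit. y" and M = M and C = C])
    fix b n s assume IH: "\<And>p s. p \<in> (UNIV :: unit set) \<Longrightarrow> s \<in> ?K \<Longrightarrow> norm (y s) \<le> b * \<bar>s\<bar> ^ n" and s: "s \<in> ?K"
    show "norm (y s) \<le> C * b * \<bar>s\<bar> ^ Suc n / real (Suc n)"
    proof (rule norm_le_power_from_derivative[OF J _ der])
      fix \<theta> :: real assume "\<theta> \<in> {0..1}"
      then have *: "\<theta> * s \<in> ?K" using s by (intro segment_scale)
      have "norm (L (\<theta> * s) (y (\<theta> * s))) \<le> norm (L (\<theta> * s)) * norm (y (\<theta> * s))" by (rule norm_blinfun)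
      also have "\<dots> \<le> C * (b * \<bar>\<theta> * s\<bar> ^ n)" using C IH[OF UNIV_I *] * by (intro mult_mono) auto
      finally show "norm (L (\<theta> * s) (y (\<theta> * s))) \<le> C * b * \<bar>\<theta> * s\<bar> ^ n" by simp
    qed (use s K \<open>y 0 = 0\<close> in auto)
  qed (use M in auto)
qed

lemma total_system_zero:
  fixes y :: "real \<Rightarrow> real \<Rightarrow> 'e::banach"
  assumes I: "interval_at_0 I" and J: "interval_at_0 J"
    and A: "continuous_on (I \<times> J) (\<lambda>(x, t). A x t)" and B: "continuous_on (I \<times> J) (\<lambda>(x, t). B x t)"
    and dx: "\<And>x t. x \<in> I \<Longrightarrow> t \<in> J \<Longrightarrow> ((\<lambda>x. y x t) has_vector_derivative blinfun_apply (A x t) (y x t)) (at x)"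
    and dt: "\<And>x t. x \<in> I \<Longrightarrow> t \<in> J \<Longrightarrow> ((\<lambda>t. y x t) has_vector_derivative blinfun_apply (B x t) (y x t)) (at t)"
    and "y 0 0 = 0" "x \<in> I" "t \<in> J"
  shows "y x t = 0"
proof (rule linear_ode_zero[OF J continuous_on_section[OF B]])
  have "0 \<in> J" using J by (simp add: interval_at_0_def)
  show "y x 0 = 0"
    by (rule linear_ode_zero[OF I continuous_on_section[OF continuous_on_swap[OF A] \<open>0 \<in> J\<close>],
          where y = "\<lambda>x. y x 0"])
      (use assms \<open>0 \<in> J\<close> in auto)
qed (use assms in auto)

text \<open>
  Integrate \<open>f\<close> along the \<open>x\<close>-axis and then \<open>g\<close> in the direction of \<open>t\<close>; closedness turns the
  \<open>x\<close>-derivative of the second integral into an increment of \<open>f\<close>.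
\<close>

lemma closed_form_potential:
  fixes f g :: "real \<Rightarrow> real \<Rightarrow> 'e::banach"
  assumes I: "interval_at_0 I" and J: "interval_at_0 J"
    and cont: "continuous_on (I \<times> J) (\<lambda>(x, t). f x t)" "continuous_on (I \<times> J) (\<lambda>(x, t). g x t)"
      "continuous_on (I \<times> J) (\<lambda>(x, t). h x t)"
    and ft: "\<And>x t. x \<in> I \<Longrightarrow> t \<in> J \<Longrightarrow> ((\<lambda>t. f x t) has_vector_derivative h x t) (at t)"
    and gx: "\<And>x t. x \<in> I \<Longrightarrow> t \<in> J \<Longrightarrow> ((\<lambda>x. g x t) has_vector_derivative h x t) (at x)"
  obtains y where "y 0 0 = c"
    "\<And>x t. x \<in> I \<Longrightarrow> t \<in> J \<Longrightarrow> ((\<lambda>x. y x t) has_vector_derivative f x t) (at x)"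
    "\<And>x t. x \<in> I \<Longrightarrow> t \<in> J \<Longrightarrow> ((\<lambda>t. y x t) has_vector_derivative g x t) (at t)"
proof -
  have J0: "0 \<in> J" using J by (simp add: interval_at_0_def)
  define y where "y x t = c + primitive (\<lambda>x. f x 0) x + primitive (g x) t" for x t
  have "((\<lambda>x. y x t) has_vector_derivative f x t) (at x)" if xt: "x \<in> I" "t \<in> J" for x t
  proof -
    have "(primitive (\<lambda>x. f x 0) has_vector_derivative f x 0) (at x)"
      by (rule has_vector_derivative_primitive[OF I xt(1) continuous_on_section[OF continuous_on_swap[OF cont(1)] J0]])
    moreover have "((\<lambda>x. primitive (g x) t) has_vector_derivative primitive (h x) t) (at x)"
      by (rule has_vector_derivative_primitive_param[OF J I xt(1) xt(2) gx
          continuous_on_swap[OF cont(2)] continuous_on_swap[OF cont(3)]])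
    ultimately have "((\<lambda>x. c + primitive (\<lambda>x. f x 0) x + primitive (g x) t)
        has_vector_derivative 0 + f x 0 + primitive (h x) t) (at x)"
      by (intro has_vector_derivative_add has_vector_derivative_const)
    then have "((\<lambda>x. y x t) has_vector_derivative f x 0 + primitive (h x) t) (at x)"
      by (simp add: y_def)
    moreover have "primitive (h x) t = f x t - f x 0"
      by (rule primitive_eq_diff[OF J xt(2) ft]) (use xt interval_at_0_scale[OF J] in auto)
    ultimately show ?thesis by simp
  qed
  moreover have "((\<lambda>t. y x t) has_vector_derivative g x t) (at t)" if xt: "x \<in> I" "t \<in> J" for x t
  proof -
    have "((\<lambda>t. y x t) has_vector_derivative 0 + 0 + g x t) (at t)"
      unfolding y_def
      by (intro has_vector_derivative_add has_vector_derivative_const xt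
        has_vector_derivative_primitive[OF J] continuous_on_section[OF cont(2)])
    then show ?thesis by simp
  qed
  moreover have "y 0 0 = c" by (simp add: y_def)
  ultimately show ?thesis using that by blast
qed

text \<open>
  The Frobenius theorem for linear systems, under the weak regularity available here: \<open>A\<close> is differentiable in
  \<open>t\<close> and \<open>B\<close> continuously so in \<open>x\<close>, just enough to state compatibility and to integrate it. Joint continuity of the solution is part
  of the conclusion, as the closed form defining \<open>S\<close> is built from such solutions.
\<close>

lemma total_system_exists:
  fixes A B :: "real \<Rightarrow> real \<Rightarrow> ('e::banach \<Rightarrow>\<^sub>L 'e)"
  assumes I: "interval_at_0 I" and J: "interval_at_0 J"
    and A: "continuous_on (I \<times> J) (\<lambda>(x, t). A x t)" and B: "continuous_on (I \<times> J) (\<lambda>(x, t). B x t)"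
    and B': "continuous_on (I \<times> J) (\<lambda>(x, t). B' x t)"
    and dA: "\<And>x t. x \<in> I \<Longrightarrow> t \<in> J \<Longrightarrow> ((\<lambda>t. A x t) has_vector_derivative A' x t) (at t)"
    and dB: "\<And>x t. x \<in> I \<Longrightarrow> t \<in> J \<Longrightarrow> ((\<lambda>x. B x t) has_vector_derivative B' x t) (at x)"
    and compat: "\<And>x t v. x \<in> I \<Longrightarrow> t \<in> J \<Longrightarrow> A' x t v + A x t (B x t v) = B' x t v + B x t (A x t v)"
  obtains y where "y 0 0 = y0" "continuous_on (I \<times> J) (\<lambda>(x, t). y x t)"
    "\<And>x t. x \<in> I \<Longrightarrow> t \<in> J \<Longrightarrow> ((\<lambda>x. y x t) has_vector_derivative blinfun_apply (A x t) (y x t)) (at x)"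
    "\<And>x t. x \<in> I \<Longrightarrow> t \<in> J \<Longrightarrow> ((\<lambda>t. y x t) has_vector_derivative blinfun_apply (B x t) (y x t)) (at t)"
proof -
  have I0: "0 \<in> I" and J0: "0 \<in> J" and "open I" "open J" using I J by (auto simp: interval_at_0_def)
  \<comment> \<open>Solve on the \<open>x\<close>-axis first. The parameter of \<open>linear_ode_exists\<close> is a dummy here.\<close>
  have A0: "continuous_on (UNIV \<times> I) (\<lambda>(p::real, x). A x 0)"
  proof -
    have "continuous_on (UNIV \<times> I) (\<lambda>w::real \<times> real. A (snd w) 0)"
      by (rule continuous_on_compose2[OF continuous_on_section[OF continuous_on_swap[OF A] J0]])
        (auto intro!: continuous_intros)
    then show ?thesis by (simp add: case_prod_unfold)
  qed
  obtain W0 :: "real \<Rightarrow> real \<Rightarrow> 'e" where W0: "\<And>p. W0 p 0 = y0"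
    "\<And>p x. x \<in> I \<Longrightarrow> ((\<lambda>x. W0 p x) has_vector_derivative A x 0 (W0 p x)) (at x)"
    using linear_ode_exists[OF I open_UNIV A0, of "\<lambda>_. y0"] by (metis UNIV_I continuous_on_const)
  define W where "W = W0 0"
  have W: "W 0 = y0" "\<And>x. x \<in> I \<Longrightarrow> (W has_vector_derivative A x 0 (W x)) (at x)"
    using W0 by (auto simp: W_def)
  have "continuous_on I W"
    using W(2) by (meson continuous_at_imp_continuous_on has_vector_derivative_continuous)
  then obtain w where wc: "continuous_on (I \<times> J) (\<lambda>(x, t). w x t)" and w0: "\<And>x. x \<in> I \<Longrightarrow> w x 0 = W x"
    and wt: "\<And>x t. x \<in> I \<Longrightarrow> t \<in> J \<Longrightarrow> ((\<lambda>t. w x t) has_vector_derivative B x t (w x t)) (at t)"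
    using linear_ode_exists[OF J \<open>open I\<close> B] by metis
  have app: "continuous_on (I \<times> J) (\<lambda>(x, t). blinfun_apply (F x t) (v x t))"
    if "continuous_on (I \<times> J) (\<lambda>(x, t). F x t)" "continuous_on (I \<times> J) (\<lambda>(x, t). v x t)"
    for F :: "real \<Rightarrow> real \<Rightarrow> ('e \<Rightarrow>\<^sub>L 'e)" and v
    using that by (auto simp: case_prod_unfold intro!: continuous_intros)
  \<comment> \<open>The expected \<open>x\<close>-derivative of \<open>w\<close>. By compatibility its \<open>t\<close>-derivative is the one that
    formal differentiation of \<open>w\<^sub>t = B w\<close> in \<open>x\<close> predicts.\<close>
  define z where "z x t = A x t (w x t)" for x t
  have zc: "continuous_on (I \<times> J) (\<lambda>(x, t). z x t)"
    unfolding z_def by (rule app[OF A wc])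
  define z' where "z' x t = B' x t (w x t) + B x t (z x t)" for x t
  have z'c: "continuous_on (I \<times> J) (\<lambda>(x, t). z' x t)"
    using app[OF B' wc] app[OF B zc] unfolding z'_def case_prod_unfold by (rule continuous_on_add)
  have zt: "((\<lambda>t. z x t) has_vector_derivative z' x t) (at t)" if xt: "x \<in> I" "t \<in> J" for x t
  proof -
    have "((\<lambda>t. z x t) has_vector_derivative A x t (B x t (w x t)) + A' x t (w x t)) (at t)"
      unfolding z_def
      by (rule bounded_bilinear.has_vector_derivative[OF bounded_bilinear_blinfun_apply dA[OF xt] wt[OF xt]])
    then show ?thesis using compat[OF xt, of "w x t"] by (simp add: z'_def z_def add.commute)
  qed
  \<comment> \<open>By construction \<open>v\<close> has \<open>x\<close>-derivative \<open>z\<close>, so it remains to show \<open>v = w\<close>.\<close>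
  define v where "v x t = w 0 t + primitive (\<lambda>x. z x t) x" for x t
  have vx: "((\<lambda>x. v x t) has_vector_derivative z x t) (at x)" if xt: "x \<in> I" "t \<in> J" for x t
  proof -
    have "((\<lambda>x. v x t) has_vector_derivative 0 + z x t) (at x)"
      unfolding v_def
      by (intro has_vector_derivative_add has_vector_derivative_const xt
        has_vector_derivative_primitive[OF I] continuous_on_section[OF continuous_on_swap[OF zc]])
    then show ?thesis by simp
  qed
  have vc: "continuous_on (I \<times> J) (\<lambda>(x, t). v x t)"
  proof -
    have "continuous_on (J \<times> I) (\<lambda>(t, x). primitive (\<lambda>x. z x t) x)"
      by (rule continuous_on_primitive[OF interval_at_0_scale[OF I] continuous_on_swap[OF zc]])
    from continuous_on_swap[OF this]
    have 1: "continuous_on (I \<times> J) (\<lambda>(x, t). primitive (\<lambda>x. z x t) x)" .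
    have "continuous_on (I \<times> J) (\<lambda>u. w 0 (snd u))"
      by (rule continuous_on_compose2[OF continuous_on_section[OF wc I0]]) (auto intro!: continuous_intros)
    from continuous_on_add[OF this 1[unfolded case_prod_unfold]]
    show ?thesis by (simp add: v_def case_prod_unfold)
  qed
  define d where "d x t = v x t - w x t" for x t
  have dc: "continuous_on (I \<times> J) (\<lambda>(x, t). d x t)"
    using continuous_on_diff[OF vc[unfolded case_prod_unfold] wc[unfolded case_prod_unfold]]
    by (simp add: d_def case_prod_unfold)
  define e where "e x t = B' x t (d x t)" for x t
  have ec: "continuous_on (I \<times> J) (\<lambda>(x, t). e x t)" unfolding e_def by (rule app[OF B' dc])
  have d0: "d x 0 = 0" if x: "x \<in> I" for x
  proof -
    have "primitive (\<lambda>x. z x 0) x = W x - W 0"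
      by (rule primitive_eq_diff[OF I x])
        (use W(2) w0 x interval_at_0_scale[OF I x] in \<open>auto simp: z_def\<close>)
    then show ?thesis using w0 x I0 by (simp add: d_def v_def)
  qed
  \<comment> \<open>The \<open>t\<close>-derivative of \<open>v\<close> is obtained under the integral sign; the integrand \<open>z'\<close> differs from
    the \<open>x\<close>-derivative of \<open>B v\<close> only by \<open>e = B' d\<close>.\<close>
  have dt: "((\<lambda>t. d x t) has_vector_derivative B x t (d x t) - primitive (\<lambda>x. e x t) x) (at t)"
    if xt: "x \<in> I" "t \<in> J" for x t
  proof -
    have 1: "((\<lambda>t. d x t) has_vector_derivative B 0 t (w 0 t) + primitive (\<lambda>x. z' x t) x - B x t (w x t)) (at t)"
      unfolding d_def v_def
      by (intro has_vector_derivative_diff has_vector_derivative_add wt xt I0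
          has_vector_derivative_primitive_param[OF I J _ _ zt zc z'c])
    have 2: "primitive (\<lambda>x. z' x t) x + primitive (\<lambda>x. e x t) x = primitive (\<lambda>x. z' x t + e x t) x"
      using interval_at_0_scale[OF I xt(1)] unfolding primitive_def scaleR_right_distrib[symmetric]
      by (intro arg_cong[where f = "scaleR x"] integral_add[symmetric] integrable_continuous_real
          continuous_on_compose2[OF continuous_on_section[OF continuous_on_swap[OF z'c] xt(2)]]
          continuous_on_compose2[OF continuous_on_section[OF continuous_on_swap[OF ec] xt(2)]])
        (auto intro!: continuous_intros)
    have 3: "primitive (\<lambda>x. z' x t + e x t) x = B x t (v x t) - B 0 t (v 0 t)"
    proof (rule primitive_eq_diff[OF I xt(1), where F = "\<lambda>x. B x t (v x t)"])
      fix \<theta> :: real assume "\<theta> \<in> {0..1}"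
      then have x': "\<theta> * x \<in> I" using interval_at_0_scale[OF I xt(1)] by auto
      let ?x = "\<theta> * x"
      have "((\<lambda>x. B x t (v x t)) has_vector_derivative B ?x t (z ?x t) + B' ?x t (v ?x t)) (at ?x)"
        by (rule bounded_bilinear.has_vector_derivative[OF bounded_bilinear_blinfun_apply dB[OF x' xt(2)] vx[OF x' xt(2)]])
      then show "((\<lambda>x. B x t (v x t)) has_vector_derivative z' ?x t + e ?x t) (at ?x)"
        by (simp add: z'_def e_def d_def blinfun.diff_right algebra_simps)
    qed
    have "v 0 t = w 0 t" by (simp add: v_def)
    moreover have "primitive (\<lambda>x. z' x t) x = B x t (v x t) - B 0 t (v 0 t) - primitive (\<lambda>x. e x t) x"
      using trans[OF 2 3] by (rule add_implies_diff)
    ultimately have "B 0 t (w 0 t) + primitive (\<lambda>x. z' x t) x - B x t (w x t)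
        = B x t (v x t) - B x t (w x t) - primitive (\<lambda>x. e x t) x"
      by simp
    also have "\<dots> = B x t (d x t) - primitive (\<lambda>x. e x t) x"
      by (simp only: d_def blinfun.diff_right)
    finally have eq: "B 0 t (w 0 t) + primitive (\<lambda>x. z' x t) x - B x t (w x t)
        = B x t (d x t) - primitive (\<lambda>x. e x t) x" .
    show ?thesis using 1 unfolding eq .
  qed
  \<comment> \<open>The equation for \<open>d\<close> at \<open>x\<close> involves all values between \<open>0\<close> and \<open>x\<close>, so the estimate is uniform
    over that segment; the integral term contributes \<open>|x| C2\<close> to the constant.\<close>
  have dz: "d x t = 0" if xt: "x \<in> I" "t \<in> J" for x t
  proof -
    let ?X = "closed_segment 0 x" and ?T = "closed_segment 0 t"
    have XI: "?X \<subseteq> I" by (rule segment_subset_interval_at_0[OF I xt(1)])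
    have TJ: "?T \<subseteq> J" by (rule segment_subset_interval_at_0[OF J xt(2)])
    have sub: "?X \<times> ?T \<subseteq> I \<times> J" using XI TJ by auto
    have comp: "compact (?X \<times> ?T)" by (intro compact_Times compact_segment)
    obtain C1 where C1: "C1 \<ge> 0" "\<And>u. u \<in> ?X \<times> ?T \<Longrightarrow> norm (case u of (x, t) \<Rightarrow> B x t) \<le> C1"
      using compact_bounded_image[OF comp continuous_on_subset[OF B sub]] by blast
    obtain C2 where C2: "C2 \<ge> 0" "\<And>u. u \<in> ?X \<times> ?T \<Longrightarrow> norm (case u of (x, t) \<Rightarrow> B' x t) \<le> C2"
      using compact_bounded_image[OF comp continuous_on_subset[OF B' sub]] by blast
    obtain M where M: "\<And>u. u \<in> ?X \<times> ?T \<Longrightarrow> norm (case u of (x, t) \<Rightarrow> d x t) \<le> M"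
      using compact_bounded_image[OF comp continuous_on_subset[OF dc sub]] by blast
    show ?thesis
    proof (rule volterra_zero[where P = ?X and K = ?T and d = d and M = M and C = "C1 + \<bar>x\<bar> * C2"])
      fix p s assume "p \<in> ?X" "s \<in> ?T" then show "norm (d p s) \<le> M" using M[of "(p, s)"] by auto
    next
      fix b n p s assume IH: "\<And>p s. p \<in> ?X \<Longrightarrow> s \<in> ?T \<Longrightarrow> norm (d p s) \<le> b * \<bar>s\<bar> ^ n"
        and p: "p \<in> ?X" and s: "s \<in> ?T"
      show "norm (d p s) \<le> (C1 + \<bar>x\<bar> * C2) * b * \<bar>s\<bar> ^ Suc n / real (Suc n)"
      proof (rule norm_le_power_from_derivative[OF J _ dt])
        fix \<theta> :: real assume \<theta>: "\<theta> \<in> {0..1}"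
        define r where "r = \<theta> * s"
        have r: "r \<in> ?T" using segment_scale[OF s \<theta>] by (simp add: r_def)
        have 1: "norm (B p r (d p r)) \<le> C1 * (b * \<bar>r\<bar> ^ n)"
          using norm_blinfun[of "B p r" "d p r"] C1(2)[of "(p, r)"] IH[OF p r] p r C1(1)
            mult_mono[of "norm (B p r)" C1 "norm (d p r)" "b * \<bar>r\<bar> ^ n"] by auto
        have 2: "norm (e q r) \<le> C2 * (b * \<bar>r\<bar> ^ n)" if q: "q \<in> ?X" for q
          using norm_blinfun[of "B' q r" "d q r"] C2(2)[of "(q, r)"] IH[OF q r] q r C2(1)
            mult_mono[of "norm (B' q r)" C2 "norm (d q r)" "b * \<bar>r\<bar> ^ n"] by (auto simp: e_def)
        have px: "\<bar>p\<bar> \<le> \<bar>x\<bar>" using p by (auto simp: closed_segment_eq_real_ivl split: if_splits)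
        have b0: "0 \<le> b * \<bar>r\<bar> ^ n" using IH[OF p r] by (meson norm_ge_zero order_trans)
        have "norm (primitive (\<lambda>x. e x r) p) \<le> C2 * (b * \<bar>r\<bar> ^ n) * \<bar>p\<bar> ^ Suc 0 / real (Suc 0)"
          by (rule norm_le_power_from_derivative[OF I _ has_vector_derivative_primitive[OF I]])
            (use p XI r TJ 2 segment_scale[OF p] continuous_on_section[OF continuous_on_swap[OF ec]] in auto)
        also have "\<dots> \<le> C2 * (b * \<bar>r\<bar> ^ n) * \<bar>x\<bar>"
          using px C2(1) b0 by (auto intro!: mult_left_mono)
        finally have "norm (B p r (d p r) - primitive (\<lambda>x. e x r) p) \<le> C1 * (b * \<bar>r\<bar> ^ n) + C2 * (b * \<bar>r\<bar> ^ n) * \<bar>x\<bar>"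
          using 1 norm_triangle_ineq4[of "B p r (d p r)" "primitive (\<lambda>x. e x r) p"] by linarith
        then show "norm (B p (\<theta> * s) (d p (\<theta> * s)) - primitive (\<lambda>x. e x (\<theta> * s)) p) \<le> (C1 + \<bar>x\<bar> * C2) * b * \<bar>\<theta> * s\<bar> ^ n"
          by (simp add: r_def algebra_simps)
      qed (use p s XI TJ d0 in auto)
    qed auto
  qed
  have "((\<lambda>x. w x t) has_vector_derivative A x t (w x t)) (at x)" if xt: "x \<in> I" "t \<in> J" for x t
    using has_vector_derivative_transform_within_open[OF vx[OF xt] \<open>open I\<close> xt(1), of "\<lambda>x. w x t"] dz xt(2)
    by (simp add: z_def d_def)
  then show ?thesis using that[OF _ wc _ wt] w0[OF I0] W(1) by simp
qed

section \<open>Matrix algebra\<close>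

lemma matrix_mult_add_left: "(A + B) ** C = A ** C + B ** (C :: complex ^ 'c ^ 'b)"
  by (simp add: matrix_matrix_mult_def vec_eq_iff sum.distrib algebra_simps)

lemma bounded_bilinear_matrix_mult:
  "bounded_bilinear ((**) :: complex ^ 'b ^ 'a \<Rightarrow> complex ^ 'c ^ 'b \<Rightarrow> complex ^ 'c ^ 'a)"
  unfolding bilinear_conv_bounded_bilinear[symmetric] bilinear_def linear_iff
  by (simp add: matrix_add_ldistrib matrix_mult_add_left scalar_matrix_assoc matrix_scalar_ac)

interpretation mm: bounded_bilinear "(**) :: complex ^ 'b ^ 'a \<Rightarrow> complex ^ 'c ^ 'b \<Rightarrow> complex ^ 'c ^ 'a"
  by (rule bounded_bilinear_matrix_mult)

text \<open>
  Identities between rectangular matrices are proved by normalizing to sums of right-nested products, after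
  which an equation \<open>X Y = \<dots>\<close> has to be supplied together with its variant for \<open>X (Y M)\<close>.
\<close>

lemmas mm_expand = mm.add_left mm.add_right mm.diff_left mm.diff_right mm.minus_left mm.minus_right
  mm.zero_left mm.zero_right matrix_mul_assoc[symmetric]

lemma bounded_linear_adj: "bounded_linear (adj :: complex ^ 'b ^ 'a \<Rightarrow> complex ^ 'a ^ 'b)"
  unfolding linear_conv_bounded_linear[symmetric] linear_iff
  by (simp add: adj_def vec_eq_iff)

lemma adj_add: "adj (A + B) = adj A + adj B"
  and adj_diff: "adj (A - B) = adj A - adj B"
  and adj_minus: "adj (- A) = - adj A"
  by (simp_all add: adj_def vec_eq_iff)

lemma adj_adj [simp]: "adj (adj A) = A"
  by (simp add: adj_def vec_eq_iff)

lemma adj_mult: "adj (A ** B) = adj B ** adj A"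
  by (simp add: adj_def matrix_matrix_mult_def vec_eq_iff mult.commute)

lemma adj_mat [simp]: "adj (mat c) = mat (cnj c)"
  by (simp add: adj_def mat_def vec_eq_iff)

lemma matrix_inv_inverse:
  assumes "invertible A"
  shows "A ** matrix_inv A = mat 1" "matrix_inv A ** A = mat 1"
  using someI_ex[OF assms[unfolded invertible_def]] by (auto simp: matrix_inv_def)

lemma matrix_inv_eqI:
  assumes "A ** B = mat 1" "B ** A = mat 1"
  shows "matrix_inv A = B"
proof -
  have "invertible A" using assms by (auto simp: invertible_def)
  then have "matrix_inv A = (matrix_inv A ** A) ** B"
    using assms by (simp add: matrix_mul_assoc[symmetric])
  then show ?thesis using \<open>invertible A\<close> by (simp add: matrix_inv_inverse)
qed

lemma invertible_adj:
  assumes "invertible A" shows "invertible (adj A)"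
  using matrix_inv_inverse[OF assms] by (metis adj_mat adj_mult complex_cnj_one invertible_def)

lemma matrix_inv_adj:
  assumes "invertible A" shows "matrix_inv (adj A) = adj (matrix_inv A)"
  using matrix_inv_inverse[OF assms] by (metis adj_mat adj_mult complex_cnj_one matrix_inv_eqI)

lemma bounded_linear_cscale: "bounded_linear (cscale c :: complex ^ 'b ^ 'a \<Rightarrow> complex ^ 'b ^ 'a)"
  unfolding linear_conv_bounded_linear[symmetric] linear_iff
  by (simp add: cscale_def vec_eq_iff algebra_simps)

lemma cscale_add: "c \<cdot>\<^sub>C (A + B) = c \<cdot>\<^sub>C A + c \<cdot>\<^sub>C B"
  and cscale_diff: "c \<cdot>\<^sub>C (A - B) = c \<cdot>\<^sub>C A - c \<cdot>\<^sub>C B"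
  and cscale_minus: "c \<cdot>\<^sub>C (- A) = - (c \<cdot>\<^sub>C A)"
  by (simp_all add: cscale_def vec_eq_iff algebra_simps)

lemma cscale_mult_left: "(c \<cdot>\<^sub>C A) ** B = c \<cdot>\<^sub>C (A ** B)"
  by (simp add: cscale_def matrix_matrix_mult_def vec_eq_iff sum_distrib_left mult.assoc)

lemma cscale_mult_right: "A ** (c \<cdot>\<^sub>C B) = c \<cdot>\<^sub>C (A ** B)"
  by (simp add: cscale_def matrix_matrix_mult_def vec_eq_iff sum_distrib_left mult.left_commute)

lemma cscale_cscale [simp]: "c \<cdot>\<^sub>C d \<cdot>\<^sub>C A = (c * d) \<cdot>\<^sub>C A"
  by (simp add: cscale_def vec_eq_iff mult.assoc)

lemma cscale_minus_left: "(- c) \<cdot>\<^sub>C A = - (c \<cdot>\<^sub>C A)"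
  by (simp add: cscale_def vec_eq_iff)

lemma cscale_one [simp]: "1 \<cdot>\<^sub>C A = A"
  by (simp add: cscale_def vec_eq_iff)

lemma adj_cscale: "adj (c \<cdot>\<^sub>C A) = cnj c \<cdot>\<^sub>C adj A"
  by (simp add: cscale_def adj_def vec_eq_iff)

lemma scaleR_eq_cscale: "r *\<^sub>R (A :: complex ^ 'b ^ 'a) = complex_of_real r \<cdot>\<^sub>C A"
  by (simp add: cscale_def vec_eq_iff) (simp add: scaleR_conv_of_real)

lemma mat_eq_cscale: "mat c = c \<cdot>\<^sub>C (mat 1 :: complex ^ 'a ^ 'a)"
  by (simp add: cscale_def mat_def vec_eq_iff)

lemma mat_mult_left: "mat c ** A = c \<cdot>\<^sub>C (A :: complex ^ 'b ^ 'a)"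
  by (subst mat_eq_cscale) (simp add: cscale_mult_left)

lemma mat_mult_right: "A ** mat c = c \<cdot>\<^sub>C (A :: complex ^ 'b ^ 'a)"
  by (subst mat_eq_cscale) (simp add: cscale_mult_right)

section \<open>Zero curvature and the linear systems it integrates\<close>

text \<open>
  The condition that \<open>\<partial>\<^sub>x + c0 + \<lambda> c1\<close> and \<open>\<partial>\<^sub>t + Q / \<lambda>\<close> commute for all \<open>\<lambda>\<close>: the two equations are the
  coefficients of \<open>\<lambda>\<^sup>0\<close> and \<open>\<lambda>\<^sup>-\<^sup>1\<close> of the commutator. Continuity is included because the linear systems
  are solved by integration.
\<close>

definition zero_curvature ::
  "real set \<Rightarrow> real set \<Rightarrow> complex ^ 'm ^ 'm \<Rightarrow> (real \<Rightarrow> real \<Rightarrow> complex ^ 'm ^ 'm) \<Rightarrow>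
   (real \<Rightarrow> real \<Rightarrow> complex ^ 'm::finite ^ 'm) \<Rightarrow> bool" where
  "zero_curvature I J c1 c0 Q \<longleftrightarrow>
     continuous_on (I \<times> J) (\<lambda>(x, t). c0 x t) \<and> continuous_on (I \<times> J) (\<lambda>(x, t). Q x t) \<and>
     (\<forall>x\<in>I. \<forall>t\<in>J. has_pd_t c0 (c1 ** Q x t - Q x t ** c1) x t \<and>
                    has_pd_x Q (Q x t ** c0 x t - c0 x t ** Q x t) x t)"

text \<open>
  The unknown stands to the left of the coefficients and the spectral parameter is replaced by the matrix \<open>A\<close>
  acting from the other side; this is the shape of the system for \<open>\<Pi>\<^sub>1\<close>.
\<close>

definition right_system ::
  "real set \<Rightarrow> real set \<Rightarrow> complex ^ 'm ^ 'm \<Rightarrow> (real \<Rightarrow> real \<Rightarrow> complex ^ 'm ^ 'm) \<Rightarrow>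
   (real \<Rightarrow> real \<Rightarrow> complex ^ 'm ^ 'm) \<Rightarrow> complex ^ 'n::finite ^ 'n \<Rightarrow>
   (real \<Rightarrow> real \<Rightarrow> complex ^ 'm::finite ^ 'n) \<Rightarrow> bool" where
  "right_system I J c1 c0 Q A Y \<longleftrightarrow> (\<forall>x\<in>I. \<forall>t\<in>J.
     has_pd_x Y (Y x t ** c0 x t + A ** Y x t ** c1) x t \<and>
     has_pd_t Y (matrix_inv A ** Y x t ** Q x t) x t)"

lemma continuous_on_mm:
  fixes f :: "'x::topological_space \<Rightarrow> complex ^ 'b ^ 'a" and g :: "'x \<Rightarrow> complex ^ 'c ^ 'b"
  shows "continuous_on S f \<Longrightarrow> continuous_on S g \<Longrightarrow> continuous_on S (\<lambda>x. f x ** g x)"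
  by (rule mm.continuous_on)

definition lmult :: "complex ^ 'b ^ 'a \<Rightarrow> (complex ^ 'c ^ 'b) \<Rightarrow>\<^sub>L (complex ^ 'c ^ 'a)" where
  "lmult = bounded_bilinear.prod_right (**)"

definition rmult :: "complex ^ 'c ^ 'b \<Rightarrow> (complex ^ 'b ^ 'a) \<Rightarrow>\<^sub>L (complex ^ 'c ^ 'a)" where
  "rmult = bounded_bilinear.prod_left (**)"

lemma lmult_apply [simp]: "blinfun_apply (lmult A) Y = A ** Y"
  by (simp add: lmult_def bounded_bilinear.prod_right.rep_eq[OF bounded_bilinear_matrix_mult])

lemma rmult_apply [simp]: "blinfun_apply (rmult B) Y = Y ** B"
  by (simp add: rmult_def bounded_bilinear.prod_left.rep_eq[OF bounded_bilinear_matrix_mult])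

lemma bounded_linear_rmult: "bounded_linear rmult"
  unfolding rmult_def by (rule bounded_bilinear.bounded_linear_prod_left[OF bounded_bilinear_matrix_mult])

locale curvature_free =
  fixes I J :: "real set" and c1 :: "complex ^ 'm::finite ^ 'm" and c0 Q :: "real \<Rightarrow> real \<Rightarrow> complex ^ 'm ^ 'm"
  assumes I: "interval_at_0 I" and J: "interval_at_0 J" and zc: "zero_curvature I J c1 c0 Q"
begin

definition op_x :: "complex ^ 'n::finite ^ 'n \<Rightarrow> real \<Rightarrow> real \<Rightarrow> (complex ^ 'm ^ 'n) \<Rightarrow>\<^sub>L (complex ^ 'm ^ 'n)" where
  "op_x A x t = rmult (c0 x t) + (lmult A o\<^sub>L rmult c1)"

definition op_t :: "complex ^ 'n::finite ^ 'n \<Rightarrow> real \<Rightarrow> real \<Rightarrow> (complex ^ 'm ^ 'n) \<Rightarrow>\<^sub>L (complex ^ 'm ^ 'n)" where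
  "op_t A x t = lmult (matrix_inv A) o\<^sub>L rmult (Q x t)"

lemma op_x_apply: "blinfun_apply (op_x A x t) Y = Y ** c0 x t + A ** Y ** c1"
  by (simp add: op_x_def blinfun.add_left matrix_mul_assoc)

lemma op_t_apply: "blinfun_apply (op_t A x t) Y = matrix_inv A ** Y ** Q x t"
  by (simp add: op_t_def matrix_mul_assoc)

lemma c0_cont: "continuous_on (I \<times> J) (\<lambda>(x, t). c0 x t)"
  and Q_cont: "continuous_on (I \<times> J) (\<lambda>(x, t). Q x t)"
  and c0_t: "x \<in> I \<Longrightarrow> t \<in> J \<Longrightarrow> ((\<lambda>t. c0 x t) has_vector_derivative c1 ** Q x t - Q x t ** c1) (at t)"
  and Q_x: "x \<in> I \<Longrightarrow> t \<in> J \<Longrightarrow> ((\<lambda>x. Q x t) has_vector_derivative Q x t ** c0 x t - c0 x t ** Q x t) (at x)"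
  using zc by (auto simp: zero_curvature_def has_pd_x_def has_pd_t_def)

lemma continuous_op_x: "continuous_on (I \<times> J) (\<lambda>(x, t). op_x A x t)"
  using c0_cont unfolding op_x_def case_prod_unfold
  by (intro continuous_intros bounded_linear.continuous_on[OF bounded_linear_rmult])

lemma bounded_linear_lmult_rmult:
  fixes A :: "complex ^ 'a ^ 'b"
  shows "bounded_linear (\<lambda>M :: complex ^ 'c ^ 'd. lmult A o\<^sub>L rmult M)"
  by (rule bounded_linear_compose[OF bounded_bilinear.bounded_linear_right[OF bounded_bilinear_blinfun_compose] bounded_linear_rmult])

lemma continuous_op_t: "continuous_on (I \<times> J) (\<lambda>(x, t). op_t A x t)"
  using Q_cont unfolding op_t_def case_prod_unfold
  by (rule bounded_linear.continuous_on[OF bounded_linear_lmult_rmult])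

text \<open>
  Compatibility reduces to zero curvature: in \<open>Y\<^sub>x\<^sub>t = Y\<^sub>t\<^sub>x\<close> the terms \<open>Y (c0)\<^sub>t\<close> and \<open>A\<^sup>-\<^sup>1 Y Q\<^sub>x\<close> are matched
  separately, the factors \<open>A\<close> and \<open>A\<^sup>-\<^sup>1\<close> cancelling in the mixed products with \<open>c1\<close>.
\<close>

lemma right_system_exists:
  fixes A :: "complex ^ 'n::finite ^ 'n"
  assumes A: "invertible A"
  obtains Y where "Y 0 0 = Y0" "continuous_on (I \<times> J) (\<lambda>(x, t). Y x t)" "right_system I J c1 c0 Q A Y"
proof (rule total_system_exists[OF I J continuous_op_x[of A] continuous_op_t[of A], where ?y0.0 = Y0])
  let ?B = "matrix_inv A"
  show "continuous_on (I \<times> J) (\<lambda>(x, t). lmult ?B o\<^sub>L rmult (Q x t ** c0 x t - c0 x t ** Q x t))"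
    using Q_cont c0_cont unfolding case_prod_unfold
    by (intro bounded_linear.continuous_on[OF bounded_linear_lmult_rmult] continuous_on_diff continuous_on_mm)
  show "((\<lambda>t. op_x A x t) has_vector_derivative rmult (c1 ** Q x t - Q x t ** c1)) (at t)"
    if "x \<in> I" "t \<in> J" for x t
  proof -
    have "((\<lambda>t. rmult (c0 x t) + (lmult A o\<^sub>L rmult c1)) has_vector_derivative rmult (c1 ** Q x t - Q x t ** c1) + 0) (at t)"
      by (intro has_vector_derivative_add has_vector_derivative_const
          bounded_linear.has_vector_derivative[OF bounded_linear_rmult] c0_t that)
    then show ?thesis by (simp add: op_x_def)
  qed
  show "((\<lambda>x. op_t A x t) has_vector_derivative lmult ?B o\<^sub>L rmult (Q x t ** c0 x t - c0 x t ** Q x t)) (at x)"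
    if "x \<in> I" "t \<in> J" for x t
    unfolding op_t_def
    by (rule bounded_linear.has_vector_derivative[OF bounded_linear_lmult_rmult Q_x[OF that]])
  have 1: "?B ** (A ** M) = M" and 2: "A ** (?B ** M) = M" for M :: "complex ^ 'm ^ 'n"
    by (simp_all add: matrix_mul_assoc matrix_inv_inverse[OF A])
  show "rmult (c1 ** Q x t - Q x t ** c1) Y + op_x A x t (op_t A x t Y) =
      (lmult ?B o\<^sub>L rmult (Q x t ** c0 x t - c0 x t ** Q x t)) Y + op_t A x t (op_x A x t Y)" for x t Y
    by (simp add: op_x_apply op_t_apply mm_expand 1 2)
next
  fix Y assume "Y 0 0 = Y0" "continuous_on (I \<times> J) (\<lambda>(x, t). Y x t)"
    "\<And>x t. x \<in> I \<Longrightarrow> t \<in> J \<Longrightarrow> ((\<lambda>x. Y x t) has_vector_derivative op_x A x t (Y x t)) (at x)"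
    "\<And>x t. x \<in> I \<Longrightarrow> t \<in> J \<Longrightarrow> ((\<lambda>t. Y x t) has_vector_derivative op_t A x t (Y x t)) (at t)"
  then show thesis
    by (intro that) (auto simp: right_system_def has_pd_x_def has_pd_t_def op_x_apply op_t_apply)
qed

lemma right_system_unique:
  fixes A :: "complex ^ 'n::finite ^ 'n"
  assumes Y: "right_system I J c1 c0 Q A Y" and Y': "right_system I J c1 c0 Q A Y'"
    and "Y 0 0 = Y' 0 0" and xt: "x \<in> I" "t \<in> J"
  shows "Y x t = Y' x t"
proof -
  have "Y x t - Y' x t = 0"
  proof (rule total_system_zero[OF I J continuous_op_x[of A] continuous_op_t[of A] _ _ _ xt])
    fix x t assume xt: "x \<in> I" "t \<in> J"
    show "((\<lambda>x. Y x t - Y' x t) has_vector_derivative op_x A x t (Y x t - Y' x t)) (at x)"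
      unfolding blinfun.diff_right op_x_apply
      by (rule has_vector_derivative_diff) (use Y Y' xt in \<open>auto simp: right_system_def has_pd_x_def\<close>)
    show "((\<lambda>t. Y x t - Y' x t) has_vector_derivative op_t A x t (Y x t - Y' x t)) (at t)"
      unfolding blinfun.diff_right op_t_apply
      by (rule has_vector_derivative_diff) (use Y Y' xt in \<open>auto simp: right_system_def has_pd_t_def\<close>)
  qed (use assms in auto)
  then show ?thesis by simp
qed

text \<open>
  The adjoint reverses products and therefore changes the sign of commutators, which the signs of the
  coefficients compensate.
\<close>

lemma curvature_free_dual: "curvature_free I J (- adj c1) (\<lambda>x t. - adj (c0 x t)) (\<lambda>x t. - adj (Q x t))"
proof (unfold_locales; (rule I J)?)
  show "zero_curvature I J (- adj c1) (\<lambda>x t. - adj (c0 x t)) (\<lambda>x t. - adj (Q x t))"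
    unfolding zero_curvature_def has_pd_x_def has_pd_t_def
  proof (intro conjI ballI)
    show "continuous_on (I \<times> J) (\<lambda>(x, t). - adj (c0 x t))" "continuous_on (I \<times> J) (\<lambda>(x, t). - adj (Q x t))"
      using c0_cont Q_cont unfolding case_prod_unfold by (auto intro!: continuous_on_minus bounded_linear.continuous_on[OF bounded_linear_adj])
    fix x t assume xt: "x \<in> I" "t \<in> J"
    show "((\<lambda>s. - adj (c0 x s)) has_vector_derivative
        - adj c1 ** - adj (Q x t) - - adj (Q x t) ** - adj c1) (at t)"
      using has_vector_derivative_minus[OF bounded_linear.has_vector_derivative[OF bounded_linear_adj c0_t[OF xt]]]
      by (simp add: adj_diff adj_mult mm_expand)
    show "((\<lambda>s. - adj (Q s t)) has_vector_derivative
        - adj (Q x t) ** - adj (c0 x t) - - adj (c0 x t) ** - adj (Q x t)) (at x)"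
      using has_vector_derivative_minus[OF bounded_linear.has_vector_derivative[OF bounded_linear_adj Q_x[OF xt]]]
      by (simp add: adj_diff adj_mult mm_expand)
  qed
qed

end

section \<open>Derivative of the matrix inverse\<close>

lemma has_vector_derivative_mm:
  fixes F :: "real \<Rightarrow> complex ^ 'b ^ 'a" and G :: "real \<Rightarrow> complex ^ 'c ^ 'b"
  assumes "(F has_vector_derivative F') (at s)" "(G has_vector_derivative G') (at s)"
  shows "((\<lambda>s. F s ** G s) has_vector_derivative F s ** G' + F' ** G s) (at s)"
  by (rule mm.has_vector_derivative[OF assms])

lemma tendsto_det:
  fixes S :: "'a \<Rightarrow> complex ^ 'n::finite ^ 'n"
  assumes "(S \<longlongrightarrow> M) F" shows "((\<lambda>x. det (S x)) \<longlongrightarrow> det M) F"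
  using assms unfolding det_def by (intro tendsto_intros)

lemma eventually_invertible:
  fixes S :: "real \<Rightarrow> complex ^ 'n::finite ^ 'n"
  assumes "isCont S s" "invertible (S s)"
  shows "eventually (\<lambda>r. invertible (S r)) (nhds s)"
proof -
  have "((\<lambda>x. det (S x)) \<longlongrightarrow> det (S s)) (at s)"
    using assms(1) by (intro tendsto_det) (simp add: isCont_def)
  then have "eventually (\<lambda>r. det (S r) \<noteq> 0) (at s)"
    by (rule tendsto_imp_eventually_ne) (use assms(2) in \<open>simp add: invertible_det_nz\<close>)
  then show ?thesis using assms(2) by (simp add: eventually_nhds_conv_at invertible_det_nz)
qed

lemma has_vector_derivative_iff_quotient:
  fixes f :: "real \<Rightarrow> 'e::real_normed_vector"
  shows "(f has_vector_derivative D) (at s) \<longleftrightarrow> ((\<lambda>r. (f r - f s) /\<^sub>R (r - s)) \<longlongrightarrow> D) (at s)"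
proof -
  have "(f has_vector_derivative D) (at s) \<longleftrightarrow>
      ((\<lambda>r. norm (f r - f s - (r - s) *\<^sub>R D) / norm (r - s)) \<longlongrightarrow> 0) (at s)"
    unfolding has_vector_derivative_def has_derivative_iff_norm
    by (simp add: bounded_linear_scaleR_left)
  also have "\<dots> \<longleftrightarrow> ((\<lambda>r. norm ((f r - f s) /\<^sub>R (r - s) - D)) \<longlongrightarrow> 0) (at s)"
  proof (rule tendsto_cong, rule eventually_at_topological[THEN iffD2], intro exI[of _ UNIV] conjI ballI impI)
    fix r assume "r \<noteq> s"
    then have "(f r - f s) /\<^sub>R (r - s) - D = (f r - f s - (r - s) *\<^sub>R D) /\<^sub>R (r - s)"
      by (simp add: scaleR_diff_right)
    then show "norm (f r - f s - (r - s) *\<^sub>R D) / norm (r - s) = norm ((f r - f s) /\<^sub>R (r - s) - D)"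
      by (simp add: divide_inverse mult.commute)
  qed auto
  also have "\<dots> \<longleftrightarrow> ((\<lambda>r. (f r - f s) /\<^sub>R (r - s)) \<longlongrightarrow> D) (at s)"
    by (simp add: tendsto_norm_zero_iff Lim_null[symmetric])
  finally show ?thesis .
qed

text \<open>
  From \<open>T(r) - T(s) = - T(r) (S(r) - S(s)) T(s)\<close>, once \<open>T = S\<^sup>-\<^sup>1\<close> is known to be continuous at \<open>s\<close>. The same
  identity first bounds \<open>T\<close> near \<open>s\<close> and then gives continuity.
\<close>

lemma has_vector_derivative_matrix_inv:
  fixes S :: "real \<Rightarrow> complex ^ 'n::finite ^ 'n"
  assumes S: "(S has_vector_derivative S') (at s)" and inv: "invertible (S s)"
  shows "((\<lambda>s. matrix_inv (S s)) has_vector_derivative - (matrix_inv (S s) ** S' ** matrix_inv (S s))) (at s)"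
proof -
  let ?T = "\<lambda>s. matrix_inv (S s)"
  have Sc: "(S \<longlongrightarrow> S s) (at s)"
    using has_vector_derivative_continuous[OF S] by (simp add: continuous_at)
  have ev: "eventually (\<lambda>r. invertible (S r)) (at s)"
    using eventually_invertible[OF has_vector_derivative_continuous[OF S] inv]
    by (simp add: eventually_nhds_conv_at)
  have diff: "?T r - ?T s = - (?T r ** (S r - S s) ** ?T s)" if "invertible (S r)" for r
    using matrix_inv_inverse[OF that] matrix_inv_inverse[OF inv]
    by (simp add: mm.diff_left mm.diff_right) (simp add: matrix_mul_assoc[symmetric])
  obtain C where C: "C > 0" "\<And>(A :: complex ^ 'n ^ 'n) (B :: complex ^ 'n ^ 'n). norm (A ** B) \<le> norm A * norm B * C"
    using mm.pos_bounded by metis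
  have Tb: "eventually (\<lambda>r. norm (?T r) \<le> 2 * norm (?T s)) (at s)"
  proof -
    \<comment> \<open>Chosen so that the correction term is at most half of the norm of \<open>T(r)\<close> and can be absorbed; \<open>C\<close>
      is the constant of submultiplicativity of the norm.\<close>
    define \<delta> where "\<delta> = 1 / (2 * C * C * (norm (?T s) + 1))"
    have \<delta>: "\<delta> > 0" using C by (auto simp: \<delta>_def intro!: divide_pos_pos mult_pos_pos add_nonneg_pos)
    show ?thesis
      using ev tendstoD[OF Sc \<delta>]
    proof eventually_elim
      case (elim r)
      have "norm (?T r) \<le> norm (?T s) + norm (?T r - ?T s)"
        using norm_triangle_sub by blast
      also have "norm (?T r - ?T s) = norm (?T r ** (S r - S s) ** ?T s)"
        by (simp add: diff[OF elim(1)])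
      also have "\<dots> \<le> norm (?T r ** (S r - S s)) * norm (?T s) * C" by (rule C(2))
      also have "\<dots> \<le> (norm (?T r) * norm (S r - S s) * C) * norm (?T s) * C"
        using C by (intro mult_right_mono) auto
      also have "\<dots> = norm (?T r) * (norm (S r - S s) * (C * C * norm (?T s)))" by simp
      also have "\<dots> \<le> norm (?T r) * (\<delta> * (C * C * (norm (?T s) + 1)))"
        using elim(2) C \<delta> by (intro mult_left_mono mult_mono) (auto simp: dist_norm)
      also have "\<delta> * (C * C * (norm (?T s) + 1)) = 1 / 2"
      proof -
        have "norm (?T s) + 1 > 0" by (simp add: add_nonneg_pos)
        then show ?thesis using C(1) by (simp add: \<delta>_def)
      qed
      finally show ?case by simp
    qed
  qed
  have "((\<lambda>r. ?T r ** (S r - S s)) \<longlongrightarrow> 0) (at s)"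
  proof (rule Lim_null_comparison)
    show "eventually (\<lambda>r. norm (?T r ** (S r - S s)) \<le> 2 * norm (?T s) * norm (S r - S s) * C) (at s)"
      using Tb
    proof eventually_elim
      case (elim r)
      have "norm (?T r ** (S r - S s)) \<le> norm (?T r) * norm (S r - S s) * C" by (rule C)
      also have "\<dots> \<le> 2 * norm (?T s) * norm (S r - S s) * C"
        using elim C by (intro mult_right_mono) auto
      finally show ?case .
    qed
    have "((\<lambda>r. 2 * norm (?T s) * norm (S r - S s) * C) \<longlongrightarrow> 2 * norm (?T s) * norm (S s - S s) * C) (at s)"
      by (intro tendsto_intros Sc)
    then show "((\<lambda>r. 2 * norm (?T s) * norm (S r - S s) * C) \<longlongrightarrow> 0) (at s)" by simp
  qed
  then have "((\<lambda>r. ?T s - ?T r ** (S r - S s) ** ?T s) \<longlongrightarrow> ?T s - 0 ** ?T s) (at s)"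
    by (intro tendsto_diff tendsto_const mm.tendsto)
  then have Tc: "(?T \<longlongrightarrow> ?T s) (at s)"
    unfolding mm.zero_left diff_0_right
  proof (rule Lim_transform_eventually)
    show "eventually (\<lambda>r. ?T s - ?T r ** (S r - S s) ** ?T s = ?T r) (at s)"
      using ev by eventually_elim (use diff in \<open>simp add: algebra_simps\<close>)
  qed
  have "((\<lambda>r. - (?T r ** ((S r - S s) /\<^sub>R (r - s)) ** ?T s)) \<longlongrightarrow> - (?T s ** S' ** ?T s)) (at s)"
    using S unfolding has_vector_derivative_iff_quotient
    by (intro tendsto_minus mm.tendsto Tc tendsto_const)
  then have "((\<lambda>r. (?T r - ?T s) /\<^sub>R (r - s)) \<longlongrightarrow> - (?T s ** S' ** ?T s)) (at s)"
  proof (rule Lim_transform_eventually)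
    show "eventually (\<lambda>r. - (?T r ** ((S r - S s) /\<^sub>R (r - s)) ** ?T s) = (?T r - ?T s) /\<^sub>R (r - s)) (at s)"
      using ev by eventually_elim (simp add: diff mm.scaleR_left mm.scaleR_right)
  qed
  then show ?thesis by (simp only: has_vector_derivative_iff_quotient)
qed

section \<open>The Sylvester identity and the Darboux matrix\<close>

text \<open>
  The algebra at one point of the domain: \<open>T\<close>, \<open>B1\<close>, \<open>B2\<close> are the inverses of \<open>S\<close>, \<open>A1\<close>, \<open>A2\<close>, and \<open>Z\<close> stands
  for \<open>\<Pi>\<^sub>2\<^sup>*\<close>. Replacing \<open>A1\<close>, \<open>A2\<close> by \<open>A1 - \<lambda>\<close>, \<open>A2 - \<lambda>\<close> preserves the identity, so the results hold for the
  Darboux matrix at every admissible \<open>\<lambda>\<close>.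
\<close>

locale sylvester =
  fixes A1 A2 S T B1 B2 :: "complex ^ 'n::finite ^ 'n" and P :: "complex ^ 'm::finite ^ 'n" and Z :: "complex ^ 'n ^ 'm"
  assumes sylvester: "A1 ** S - S ** A2 = P ** Z"
    and S: "S ** T = mat 1" and A1: "A1 ** B1 = mat 1" and A2: "A2 ** B2 = mat 1"
begin

lemma inverses: "S ** T = mat 1" "T ** S = mat 1" "A1 ** B1 = mat 1" "B1 ** A1 = mat 1" "A2 ** B2 = mat 1" "B2 ** A2 = mat 1"
  "S ** (T ** M) = M" "T ** (S ** M) = M" "A1 ** (B1 ** M) = M" "B1 ** (A1 ** M) = M" "A2 ** (B2 ** M) = M" "B2 ** (A2 ** M) = M"
  for M :: "complex ^ 'k ^ 'n"
  using S A1 A2 S[unfolded matrix_left_right_inverse[of S]] A1[unfolded matrix_left_right_inverse[of A1]]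
    A2[unfolded matrix_left_right_inverse[of A2]]
  by (simp_all add: matrix_mul_assoc)

text \<open>
  The Sylvester identity multiplied by \<open>S\<^sup>-\<^sup>1\<close> on both sides. Used as a rewrite rule it eliminates the factors
  \<open>P Z\<close> that stand between two inverses of \<open>S\<close>.
\<close>

lemma TPZT: "T ** (P ** (Z ** T)) = T ** A1 - A2 ** T"
proof -
  have "T ** (P ** (Z ** T)) = T ** ((P ** Z) ** T)" by (simp only: matrix_mul_assoc)
  then show ?thesis by (simp add: sylvester[symmetric] mm_expand inverses)
qed

lemma TPZT': "T ** (P ** (Z ** (T ** M))) = T ** (A1 ** M) - A2 ** (T ** M)" for M :: "complex ^ 'k ^ 'n"
proof -
  have "T ** (P ** (Z ** (T ** M))) = (T ** (P ** (Z ** T))) ** M" by (simp only: matrix_mul_assoc)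
  then show ?thesis unfolding TPZT by (simp add: mm_expand)
qed

lemma PBZ: "B1 ** (P ** (Z ** B2)) = S ** B2 - B1 ** S"
proof -
  have "B1 ** (P ** (Z ** B2)) = B1 ** ((P ** Z) ** B2)" by (simp only: matrix_mul_assoc)
  then show ?thesis by (simp add: sylvester[symmetric] mm_expand inverses)
qed

lemma PBZ': "B1 ** (P ** (Z ** (B2 ** M))) = S ** (B2 ** M) - B1 ** (S ** M)" for M :: "complex ^ 'k ^ 'n"
proof -
  have "B1 ** (P ** (Z ** (B2 ** M))) = (B1 ** (P ** (Z ** B2))) ** M" by (simp only: matrix_mul_assoc)
  then show ?thesis unfolding PBZ by (simp add: mm_expand)
qed

text \<open>
  The realization formula for the inverse of a transfer function: the cross term
  \<open>Z B2 T P Z T B1 P\<close> collapses to \<open>Z B2 T P - Z T B1 P\<close> by the Sylvester identity.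
\<close>

lemma darboux_inverse:
  "(mat 1 + Z ** B2 ** T ** P) ** (mat 1 - Z ** T ** B1 ** P) = mat 1"
  "(mat 1 - Z ** T ** B1 ** P) ** (mat 1 + Z ** B2 ** T ** P) = mat 1"
  by (simp_all add: mm_expand inverses TPZT' PBZ')

text \<open>
  The left sides of the next three equations are what the product rule gives for the derivatives of \<open>Z T\<close> and
  \<open>T P\<close>; the right sides show that these products solve the original linear systems with modified
  coefficients.
\<close>

lemma K_x_algebra: "Z ** (- (T ** (P ** c1 ** Z) ** T)) + (- (c0 ** Z) - c1 ** Z ** A2) ** T
   = - ((c0 - c1 ** (Z ** T ** P) + (Z ** T ** P) ** c1) ** (Z ** T)) - c1 ** (Z ** T) ** A1"
  by (simp add: mm_expand inverses TPZT TPZT' algebra_simps)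

lemma L_x_algebra: "T ** (P ** c0 + A1 ** P ** c1) + (- (T ** (P ** c1 ** Z) ** T)) ** P
   = (T ** P) ** (c0 - c1 ** (Z ** T ** P) + (Z ** T ** P) ** c1) + A2 ** (T ** P) ** c1"
  by (simp add: mm_expand inverses TPZT TPZT' algebra_simps)

lemma K_t_algebra: "Z ** (- (T ** - (B1 ** P ** Q ** Z ** B2) ** T)) + (- (Q ** Z ** B2)) ** T
   = - (((mat 1 - Z ** T ** B1 ** P) ** Q ** (mat 1 + Z ** B2 ** T ** P)) ** (Z ** T) ** B1)"
  by (simp add: mm_expand inverses TPZT TPZT' algebra_simps)

end

text \<open>
  Here \<open>Z\<close> stands for \<open>\<Pi>\<^sub>2\<^sup>*\<close>, which turns the adjoints in the system for \<open>\<Pi>\<^sub>2\<close> into plain products, and \<open>P\<close>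
  for \<open>\<Pi>\<^sub>1\<close>. Zero curvature of \<open>c0\<close> and \<open>Q\<close> is inherited from the parent locale.
\<close>

locale gbdt = curvature_free I J c1 c0 Q
  for I J :: "real set" and c1 :: "complex ^ 'm::finite ^ 'm" and c0 Q :: "real \<Rightarrow> real \<Rightarrow> complex ^ 'm ^ 'm" +
  fixes A1 A2 B1 B2 :: "complex ^ 'n::finite ^ 'n"
    and P :: "real \<Rightarrow> real \<Rightarrow> complex ^ 'm ^ 'n" and Z :: "real \<Rightarrow> real \<Rightarrow> complex ^ 'n ^ 'm"
    and S :: "real \<Rightarrow> real \<Rightarrow> complex ^ 'n ^ 'n"
  assumes A1: "A1 ** B1 = mat 1" and A2: "A2 ** B2 = mat 1"
    and P_x: "\<And>x t. x \<in> I \<Longrightarrow> t \<in> J \<Longrightarrow>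
      ((\<lambda>x. P x t) has_vector_derivative P x t ** c0 x t + A1 ** P x t ** c1) (at x)"
    and P_t: "\<And>x t. x \<in> I \<Longrightarrow> t \<in> J \<Longrightarrow> ((\<lambda>t. P x t) has_vector_derivative B1 ** P x t ** Q x t) (at t)"
    and Z_x: "\<And>x t. x \<in> I \<Longrightarrow> t \<in> J \<Longrightarrow>
      ((\<lambda>x. Z x t) has_vector_derivative - (c0 x t ** Z x t) - c1 ** Z x t ** A2) (at x)"
    and Z_t: "\<And>x t. x \<in> I \<Longrightarrow> t \<in> J \<Longrightarrow> ((\<lambda>t. Z x t) has_vector_derivative - (Q x t ** Z x t ** B2)) (at t)"
    and S_x: "\<And>x t. x \<in> I \<Longrightarrow> t \<in> J \<Longrightarrow> ((\<lambda>x. S x t) has_vector_derivative P x t ** c1 ** Z x t) (at x)"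
    and S_t: "\<And>x t. x \<in> I \<Longrightarrow> t \<in> J \<Longrightarrow>
      ((\<lambda>t. S x t) has_vector_derivative - (B1 ** P x t ** Q x t ** Z x t ** B2)) (at t)"
    and sylvester_0: "A1 ** S 0 0 - S 0 0 ** A2 = P 0 0 ** Z 0 0"
begin

lemma B1_A1: "B1 ** A1 = mat 1" and B2_A2: "B2 ** A2 = mat 1"
  using A1 A2 by (simp_all add: matrix_left_right_inverse)

lemma cancel: "A1 ** (B1 ** M) = M" "B1 ** (A1 ** M) = M" "A2 ** (B2 ** M) = M" "B2 ** (A2 ** M) = M"
  for M :: "complex ^ 'k ^ 'n"
  by (simp_all add: matrix_mul_assoc A1 A2 B1_A1 B2_A2)

text \<open>
  In both directions the derivatives of the two sides agree: the terms with \<open>c0\<close> cancel in the derivative of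
  \<open>P Z\<close>, and the others are the derivatives of \<open>A1 S\<close> and \<open>S A2\<close>.
\<close>

lemma sylvester_identity:
  assumes xt: "x \<in> I" "t \<in> J"
  shows "A1 ** S x t - S x t ** A2 = P x t ** Z x t"
proof -
  have "A1 ** S x t - S x t ** A2 - P x t ** Z x t = 0"
  proof (rule total_system_zero[OF I J, where A = "\<lambda>x t. 0" and B = "\<lambda>x t. 0"])
    fix x t assume xt: "x \<in> I" "t \<in> J"
    have const: "((\<lambda>s. C) has_vector_derivative 0) (at r)" for C :: "complex ^ 'n ^ 'n" and r :: real
      by (rule has_vector_derivative_const)
    show "((\<lambda>x. A1 ** S x t - S x t ** A2 - P x t ** Z x t) has_vector_derivative
        blinfun_apply 0 (A1 ** S x t - S x t ** A2 - P x t ** Z x t)) (at x)"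
      using has_vector_derivative_diff[OF has_vector_derivative_diff[OF
          has_vector_derivative_mm[OF const[of A1] S_x[OF xt]] has_vector_derivative_mm[OF S_x[OF xt] const[of A2]]]
          has_vector_derivative_mm[OF P_x[OF xt] Z_x[OF xt]]]
      by (simp add: mm_expand cancel)
    show "((\<lambda>t. A1 ** S x t - S x t ** A2 - P x t ** Z x t) has_vector_derivative
        blinfun_apply 0 (A1 ** S x t - S x t ** A2 - P x t ** Z x t)) (at t)"
      using has_vector_derivative_diff[OF has_vector_derivative_diff[OF
          has_vector_derivative_mm[OF const[of A1] S_t[OF xt]] has_vector_derivative_mm[OF S_t[OF xt] const[of A2]]]
          has_vector_derivative_mm[OF P_t[OF xt] Z_t[OF xt]]]
      by (simp add: mm_expand cancel B2_A2)
  qed (use sylvester_0 xt in auto)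
  then show ?thesis by simp
qed

text \<open>
  \<open>dbx M\<close> with \<open>M = (A1 - \<lambda>)\<^sup>-\<^sup>1\<close> is the Darboux matrix at \<open>\<lambda>\<close>. In particular \<open>dbx B1\<close> is its value at
  \<open>\<lambda> = 0\<close>, that is \<open>I - X\<^sub>-\<^sub>1\<close>, and \<open>dbx_inv = I + Y\<^sub>-\<^sub>1\<close> is the inverse of that value. The transformed
  coefficients are \<open>c0'\<close> and \<open>Q'\<close>.
\<close>

definition T where "T x t = matrix_inv (S x t)"
definition K where "K x t = Z x t ** T x t"
definition L where "L x t = T x t ** P x t"
definition c0' where "c0' x t = c0 x t - c1 ** (K x t ** P x t) + (K x t ** P x t) ** c1"
definition dbx where "dbx M x t = mat 1 - K x t ** M ** P x t"
definition dbx_inv where "dbx_inv x t = mat 1 + Z x t ** B2 ** L x t"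
definition Q' where "Q' x t = dbx B1 x t ** Q x t ** dbx_inv x t"

definition regular where "regular x t \<longleftrightarrow> x \<in> I \<and> t \<in> J \<and> invertible (S x t)"

lemma regularD: "regular x t \<Longrightarrow> x \<in> I" "regular x t \<Longrightarrow> t \<in> J" "regular x t \<Longrightarrow> invertible (S x t)"
  by (auto simp: regular_def)

lemma sylvester_at:
  assumes "regular x t"
  shows "sylvester A1 A2 (S x t) (T x t) B1 B2 (P x t) (Z x t)"
  by unfold_locales (use assms in \<open>simp_all add: A1 A2 sylvester_identity T_def matrix_inv_inverse regular_def\<close>)

lemma T_x: "regular x t \<Longrightarrow> ((\<lambda>x. T x t) has_vector_derivative - (T x t ** (P x t ** c1 ** Z x t) ** T x t)) (at x)"
  unfolding T_def by (rule has_vector_derivative_matrix_inv[OF S_x]) (auto simp: regular_def)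

lemma T_t: "regular x t \<Longrightarrow> ((\<lambda>t. T x t) has_vector_derivative
    - (T x t ** - (B1 ** P x t ** Q x t ** Z x t ** B2) ** T x t)) (at t)"
  unfolding T_def by (rule has_vector_derivative_matrix_inv[OF S_t]) (auto simp: regular_def)

lemma K_x: assumes r: "regular x t"
  shows "((\<lambda>x. K x t) has_vector_derivative - (c0' x t ** K x t) - c1 ** K x t ** A1) (at x)"
  using has_vector_derivative_mm[OF Z_x[OF regularD(1)[OF r] regularD(2)[OF r]] T_x[OF r]]
  unfolding K_def c0'_def sylvester.K_x_algebra[OF sylvester_at[OF r]] .

lemma L_x: assumes r: "regular x t"
  shows "((\<lambda>x. L x t) has_vector_derivative L x t ** c0' x t + A2 ** L x t ** c1) (at x)"
  using has_vector_derivative_mm[OF T_x[OF r] P_x[OF regularD(1)[OF r] regularD(2)[OF r]]]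
  unfolding K_def L_def c0'_def sylvester.L_x_algebra[OF sylvester_at[OF r]] .

lemma Q'_eq: "Q' x t = (mat 1 - Z x t ** T x t ** B1 ** P x t) ** Q x t ** (mat 1 + Z x t ** B2 ** T x t ** P x t)"
  by (simp add: Q'_def dbx_def dbx_inv_def K_def L_def matrix_mul_assoc)

lemma K_t: assumes r: "regular x t"
  shows "((\<lambda>t. K x t) has_vector_derivative - (Q' x t ** K x t ** B1)) (at t)"
  using has_vector_derivative_mm[OF Z_t[OF regularD(1)[OF r] regularD(2)[OF r]] T_t[OF r]]
  unfolding K_def Q'_eq sylvester.K_t_algebra[OF sylvester_at[OF r]] .

lemma dbx_inv_dbx: assumes r: "regular x t"
  shows "dbx_inv x t ** dbx B1 x t = mat 1"
  using sylvester.darboux_inverse(1)[OF sylvester_at[OF r]]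
  by (simp add: dbx_def dbx_inv_def K_def L_def matrix_mul_assoc)

text \<open>
  This is \<open>Q' (I - X\<^sub>-\<^sub>1) = (I - X\<^sub>-\<^sub>1) Q\<close>, solved for \<open>Q' X\<^sub>-\<^sub>1\<close> so that it can serve as a rewrite rule.
\<close>

lemma Q'_K: assumes r: "regular x t"
  shows "Q' x t ** (K x t ** (B1 ** P x t)) = Q' x t - Q x t + K x t ** (B1 ** (P x t ** Q x t))"
proof -
  have "Q' x t ** dbx B1 x t = dbx B1 x t ** Q x t ** (dbx_inv x t ** dbx B1 x t)"
    by (simp add: Q'_def matrix_mul_assoc)
  then show ?thesis unfolding dbx_inv_dbx[OF r] by (simp add: dbx_def mm_expand algebra_simps)
qed

text \<open>
  The hypotheses on \<open>M\<close> say that it is a two-sided inverse of \<open>A1 - l\<close>. Stated in this form they move \<open>A1\<close>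
  past \<open>M\<close>, turning the matrix parameter of the systems for \<open>K\<close> and \<open>P\<close> into the scalar \<open>l\<close>.
\<close>

lemma dbx_x:
  assumes r: "regular x t" and M: "A1 ** M = mat 1 + l \<cdot>\<^sub>C M" "M ** A1 = mat 1 + l \<cdot>\<^sub>C M"
  shows "((\<lambda>x. dbx M x t) has_vector_derivative
    dbx M x t ** (c0 x t + l \<cdot>\<^sub>C c1) - (c0' x t + l \<cdot>\<^sub>C c1) ** dbx M x t) (at x)"
proof -
  have MM: "A1 ** (M ** N) = N + l \<cdot>\<^sub>C (M ** N)" "M ** (A1 ** N) = N + l \<cdot>\<^sub>C (M ** N)"
    for N :: "complex ^ 'k ^ 'n"
    using M by (simp_all add: matrix_mul_assoc mm.add_left cscale_mult_left)
  have "((\<lambda>x. mat 1 - (K x t ** M) ** P x t) has_vector_derivative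
      0 - (K x t ** M ** (P x t ** c0 x t + A1 ** P x t ** c1) +
        (K x t ** 0 + (- (c0' x t ** K x t) - c1 ** K x t ** A1) ** M) ** P x t)) (at x)"
    by (rule has_vector_derivative_diff has_vector_derivative_mm has_vector_derivative_const
        K_x[OF r] P_x[OF regularD(1)[OF r] regularD(2)[OF r]])+
  moreover have "0 - (K x t ** M ** (P x t ** c0 x t + A1 ** P x t ** c1) +
        (K x t ** 0 + (- (c0' x t ** K x t) - c1 ** K x t ** A1) ** M) ** P x t)
      = dbx M x t ** (c0 x t + l \<cdot>\<^sub>C c1) - (c0' x t + l \<cdot>\<^sub>C c1) ** dbx M x t"
    by (simp add: dbx_def mm_expand MM cscale_mult_left cscale_mult_right cscale_add cscale_diff c0'_def)
  ultimately show ?thesis unfolding dbx_def by simp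
qed

text \<open>
  The partial fraction \<open>A1\<^sup>-\<^sup>1 (A1 - l)\<^sup>-\<^sup>1 = ((A1 - l)\<^sup>-\<^sup>1 - A1\<^sup>-\<^sup>1) / l\<close> splits the derivative into the wanted
  terms and terms at \<open>l = 0\<close>; the latter cancel because \<open>Q'\<close> is conjugate to \<open>Q\<close>.
\<close>

lemma dbx_t:
  assumes r: "regular x t" and l: "l \<noteq> 0" and M: "A1 ** M = mat 1 + l \<cdot>\<^sub>C M" "M ** A1 = mat 1 + l \<cdot>\<^sub>C M"
  shows "((\<lambda>t. dbx M x t) has_vector_derivative
    (1 / l) \<cdot>\<^sub>C (dbx M x t ** Q x t - Q' x t ** dbx M x t)) (at t)"
proof -
  have BM: "B1 ** M = (1 / l) \<cdot>\<^sub>C (M - B1)"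
  proof -
    have "B1 ** (A1 ** M) = B1 + l \<cdot>\<^sub>C (B1 ** M)" unfolding M by (simp add: mm.add_right cscale_mult_right)
    then have "l \<cdot>\<^sub>C (B1 ** M) = M - B1" unfolding cancel by (metis add_diff_cancel_left')
    then have "(1 / l) \<cdot>\<^sub>C l \<cdot>\<^sub>C (B1 ** M) = (1 / l) \<cdot>\<^sub>C (M - B1)" by simp
    then show ?thesis using l by simp
  qed
  have MB: "M ** B1 = (1 / l) \<cdot>\<^sub>C (M - B1)"
  proof -
    have "M ** A1 ** B1 = B1 + l \<cdot>\<^sub>C (M ** B1)" unfolding M by (simp add: mm.add_left cscale_mult_left)
    then have "l \<cdot>\<^sub>C (M ** B1) = M - B1"
      unfolding matrix_mul_assoc[symmetric] A1 matrix_mul_rid by (metis add_diff_cancel_left')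
    then have "(1 / l) \<cdot>\<^sub>C l \<cdot>\<^sub>C (M ** B1) = (1 / l) \<cdot>\<^sub>C (M - B1)" by simp
    then show ?thesis using l by simp
  qed
  have BM': "B1 ** (M ** N) = (1 / l) \<cdot>\<^sub>C (M ** N - B1 ** N)" "M ** (B1 ** N) = (1 / l) \<cdot>\<^sub>C (M ** N - B1 ** N)"
    for N :: "complex ^ 'k ^ 'n"
    using BM MB by (simp_all add: matrix_mul_assoc mm.diff_left cscale_mult_left)
  have "((\<lambda>t. mat 1 - (K x t ** M) ** P x t) has_vector_derivative
      0 - (K x t ** M ** (B1 ** P x t ** Q x t) + (K x t ** 0 + (- (Q' x t ** K x t ** B1)) ** M) ** P x t)) (at t)"
    by (rule has_vector_derivative_diff has_vector_derivative_mm has_vector_derivative_const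
        K_t[OF r] P_t[OF regularD(1)[OF r] regularD(2)[OF r]])+
  moreover have "0 - (K x t ** M ** (B1 ** P x t ** Q x t) + (K x t ** 0 + (- (Q' x t ** K x t ** B1)) ** M) ** P x t)
      = (1 / l) \<cdot>\<^sub>C (dbx M x t ** Q x t - Q' x t ** dbx M x t)"
    by (simp add: dbx_def mm_expand BM' Q'_K[OF r] cscale_mult_left cscale_mult_right cscale_add cscale_diff)
  ultimately show ?thesis unfolding dbx_def by simp
qed

lemma dbx_inv_x:
  assumes r: "regular x t"
  shows "((\<lambda>x. dbx_inv x t) has_vector_derivative dbx_inv x t ** c0' x t - c0 x t ** dbx_inv x t) (at x)"
proof -
  have "((\<lambda>x. mat 1 + (Z x t ** B2) ** L x t) has_vector_derivative
      0 + (Z x t ** B2 ** (L x t ** c0' x t + A2 ** L x t ** c1) +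
        (Z x t ** 0 + (- (c0 x t ** Z x t) - c1 ** Z x t ** A2) ** B2) ** L x t)) (at x)"
    by (rule has_vector_derivative_add has_vector_derivative_mm has_vector_derivative_const
        L_x[OF r] Z_x[OF regularD(1)[OF r] regularD(2)[OF r]])+
  moreover have "0 + (Z x t ** B2 ** (L x t ** c0' x t + A2 ** L x t ** c1) +
        (Z x t ** 0 + (- (c0 x t ** Z x t) - c1 ** Z x t ** A2) ** B2) ** L x t)
      = dbx_inv x t ** c0' x t - c0 x t ** dbx_inv x t"
    by (simp add: dbx_inv_def mm_expand cancel c0'_def K_def L_def)
  ultimately show ?thesis unfolding dbx_inv_def by simp
qed

text \<open>
  Since \<open>dbx B1\<close> and its inverse intertwine \<open>c0\<close> with \<open>c0'\<close>, conjugation carries \<open>Q\<^sub>x = [Q, c0]\<close> over to \<open>Q'\<close>.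
\<close>

lemma Q'_x:
  assumes r: "regular x t"
  shows "((\<lambda>x. Q' x t) has_vector_derivative Q' x t ** c0' x t - c0' x t ** Q' x t) (at x)"
proof -
  have "A1 ** B1 = mat 1 + 0 \<cdot>\<^sub>C B1" "B1 ** A1 = mat 1 + 0 \<cdot>\<^sub>C B1"
    by (simp_all add: A1 B1_A1 cscale_def vec_eq_iff)
  from dbx_x[OF r this]
  have dbx: "((\<lambda>x. dbx B1 x t) has_vector_derivative dbx B1 x t ** c0 x t - c0' x t ** dbx B1 x t) (at x)"
    by (simp add: cscale_def[of 0] zero_vec_def[symmetric])
  have "((\<lambda>x. dbx B1 x t ** Q x t ** dbx_inv x t) has_vector_derivative
     dbx B1 x t ** Q x t ** (dbx_inv x t ** c0' x t - c0 x t ** dbx_inv x t) +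
     (dbx B1 x t ** (Q x t ** c0 x t - c0 x t ** Q x t) + (dbx B1 x t ** c0 x t - c0' x t ** dbx B1 x t) ** Q x t) ** dbx_inv x t) (at x)"
    by (intro has_vector_derivative_mm dbx dbx_inv_x[OF r] Q_x regularD[OF r])
  then show ?thesis by (simp add: Q'_def mm_expand)
qed

text \<open>
  The point is \<open>(X0)\<^sub>t = Q - Q'\<close>: subtracting \<open>[c1, Q - Q']\<close> from \<open>(c0)\<^sub>t = [c1, Q]\<close> leaves \<open>[c1, Q']\<close>.
\<close>

lemma c0'_t:
  assumes r: "regular x t"
  shows "((\<lambda>t. c0' x t) has_vector_derivative c1 ** Q' x t - Q' x t ** c1) (at t)"
proof -
  have "((\<lambda>t. K x t ** P x t) has_vector_derivative
      K x t ** (B1 ** P x t ** Q x t) + - (Q' x t ** K x t ** B1) ** P x t) (at t)"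
    by (intro has_vector_derivative_mm K_t[OF r] P_t regularD[OF r])
  then have X0: "((\<lambda>t. K x t ** P x t) has_vector_derivative Q x t - Q' x t) (at t)"
    by (simp add: mm_expand Q'_K[OF r])
  have "((\<lambda>t. c0 x t - c1 ** (K x t ** P x t) + (K x t ** P x t) ** c1) has_vector_derivative
      c1 ** Q x t - Q x t ** c1 - (c1 ** (Q x t - Q' x t) + 0 ** (K x t ** P x t)) +
        ((K x t ** P x t) ** 0 + (Q x t - Q' x t) ** c1)) (at t)"
    by (intro has_vector_derivative_add has_vector_derivative_diff has_vector_derivative_mm
        has_vector_derivative_const X0 c0_t regularD[OF r])
  then show ?thesis by (simp add: c0'_def mm_expand)
qed

end

section \<open>Block structure and the coupled dispersionless equations\<close>

lemma jmat_nth: "(jmat :: complex ^ ('a::finite + 'b::finite) ^ ('a + 'b)) $ i $ k =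
    (if i = k then (case i of Inl _ \<Rightarrow> 1 | Inr _ \<Rightarrow> - 1) else 0)"
  by (auto simp: jmat_def four_block_def mat_def split: sum.splits)

lemma jmat_mult_nth: "(jmat ** M) $ i $ k = (case i of Inl _ \<Rightarrow> M $ i $ k | Inr _ \<Rightarrow> - M $ i $ k)"
  by (simp add: matrix_matrix_mult_def jmat_nth if_distrib[of "\<lambda>x. x * _"] cong: if_cong split: sum.splits)

lemma mult_jmat_nth: "(M ** jmat) $ i $ k = (case k of Inl _ \<Rightarrow> M $ i $ k | Inr _ \<Rightarrow> - M $ i $ k)"
  by (simp add: matrix_matrix_mult_def jmat_nth if_distrib[of "\<lambda>x. _ * x"] cong: if_cong split: sum.splits)

lemma jmat_jmat [simp]: "jmat ** jmat = mat 1" "jmat ** (jmat ** M) = M"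
  by (auto simp: vec_eq_iff jmat_mult_nth jmat_nth mat_def split: sum.splits)

lemma adj_jmat [simp]: "adj jmat = jmat"
  by (auto simp: vec_eq_iff adj_def jmat_nth split: sum.splits)

lemma block_diagonal_iff: "block_diagonal M \<longleftrightarrow> M ** jmat = jmat ** M"
proof
  assume "block_diagonal M"
  then show "M ** jmat = jmat ** M"
    by (auto simp: block_diagonal_def vec_eq_iff jmat_mult_nth mult_jmat_nth four_block_def split: sum.splits)
next
  assume *: "M ** jmat = jmat ** M"
  have "M = four_block (\<chi> r s. M $ Inl r $ Inl s) 0 0 (\<chi> r s. M $ Inr r $ Inr s)"
    unfolding vec_eq_iff
  proof (intro allI)
    fix i k
    from * have "(M ** jmat) $ i $ k = (jmat ** M) $ i $ k" by simp
    then show "M $ i $ k = four_block (\<chi> r s. M $ Inl r $ Inl s) 0 0 (\<chi> r s. M $ Inr r $ Inr s) $ i $ k"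
      by (auto simp: jmat_mult_nth mult_jmat_nth four_block_def split: sum.splits)
  qed
  then show "block_diagonal M" unfolding block_diagonal_def by blast
qed

lemma block_offdiagonal_iff: "block_offdiagonal M \<longleftrightarrow> M ** jmat = - (jmat ** M)"
proof
  assume "block_offdiagonal M"
  then show "M ** jmat = - (jmat ** M)"
    by (auto simp: block_offdiagonal_def vec_eq_iff jmat_mult_nth mult_jmat_nth four_block_def split: sum.splits)
next
  assume *: "M ** jmat = - (jmat ** M)"
  have "M = four_block 0 (\<chi> r s. M $ Inl r $ Inr s) (\<chi> r s. M $ Inr r $ Inl s) 0"
    unfolding vec_eq_iff
  proof (intro allI)
    fix i k
    from * have "(M ** jmat) $ i $ k = (- (jmat ** M)) $ i $ k" by simp
    then show "M $ i $ k = four_block 0 (\<chi> r s. M $ Inl r $ Inr s) (\<chi> r s. M $ Inr r $ Inl s) 0 $ i $ k"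
      by (auto simp: jmat_mult_nth mult_jmat_nth four_block_def split: sum.splits)
  qed
  then show "block_offdiagonal M" unfolding block_offdiagonal_def by blast
qed

lemma block_diagonal_commute:
  assumes "block_diagonal M"
  shows "M ** jmat = jmat ** M" "M ** (jmat ** N) = jmat ** (M ** N)"
  using assms by (simp_all add: block_diagonal_iff matrix_mul_assoc)

lemma block_offdiagonal_anticommute:
  assumes "block_offdiagonal M"
  shows "M ** jmat = - (jmat ** M)" "M ** (jmat ** N) = - (jmat ** (M ** N))"
  using assms by (simp_all add: block_offdiagonal_iff matrix_mul_assoc mm.minus_left)

lemma jpow_simps: "jpow 0 = mat 1" "jpow (Suc 0) = jmat" "jpow (Suc (Suc 0)) = mat 1"
  by (simp_all add: jpow_def)

lemmas cscale_simps = cscale_mult_left cscale_mult_right cscale_add cscale_diff cscale_minus scaleR_eq_cscale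

lemma matrix_eq_nthI: "(\<And>i k. A $ i $ k = B $ i $ k) \<Longrightarrow> A = B"
  by (simp add: vec_eq_iff)

lemma cscale_nth: "(c \<cdot>\<^sub>C A) $ i $ k = c * A $ i $ k"
  by (simp add: cscale_def)

text \<open>
  Every \<open>Q\<close> is uniquely of the form \<open>\<i> j R - j\<^sup>p U\<close> with \<open>R\<close> block diagonal and \<open>U\<close> block off-diagonal;
  \<open>diag_part\<close> and \<open>offdiag_part\<close> recover \<open>R\<close> and \<open>U\<close>. For \<open>Q = Qm1\<close> these are the solution \<open>R\<close> and the derivative
  \<open>V\<^sub>t\<close>, and for the transformed coefficient the first one is \<open>R_new\<close>.
\<close>

definition diag_part :: "complex ^ ('a::finite + 'b::finite) ^ ('a + 'b) \<Rightarrow> complex ^ ('a + 'b) ^ ('a + 'b)" where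
  "diag_part Q = (1 / (2 * \<i>)) \<cdot>\<^sub>C (Q ** jmat + jmat ** Q)"

definition offdiag_part :: "nat \<Rightarrow> complex ^ ('a::finite + 'b::finite) ^ ('a + 'b) \<Rightarrow> complex ^ ('a + 'b) ^ ('a + 'b)" where
  "offdiag_part p Q = (- 1 / 2) \<cdot>\<^sub>C (jpow p ** (Q - jmat ** Q ** jmat))"

text \<open>
  Commuting with \<open>j\<close> annihilates the block diagonal part of \<open>Q\<close> and multiplies the off-diagonal one by \<open>2 j\<close>.
\<close>

lemma curvature_t_algebra:
  assumes p: "p \<in> {0, 1}" and R: "block_diagonal R" and U: "block_offdiagonal U"
    and Q: "Q = \<i> \<cdot>\<^sub>C (jmat ** R) - jpow p ** U"
  shows "q1 ** Q - Q ** q1 = (\<i> / 2) \<cdot>\<^sub>C (jpow (p + 1) ** U)"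
  using p
  by (auto simp: q1_def Q jpow_simps mm_expand cscale_simps block_diagonal_commute[OF R]
      block_offdiagonal_anticommute[OF U] cscale_minus_left intro!: matrix_eq_nthI)
    (simp_all add: cscale_nth field_simps)

text \<open>
  The right side is \<open>\<i> j R\<^sub>x - j\<^sup>p V\<^sub>t\<^sub>x\<close> with both derivatives replaced according to the dispersionless
  equations (and \<open>U = V\<^sub>t\<close>). Since such a decomposition is unique, the lemma serves to pass from the equations
  to zero curvature and, for the transformed coefficients, back again.
\<close>

lemma curvature_x_algebra:
  assumes p: "p \<in> {0, 1}" and R: "block_diagonal R" and U: "block_offdiagonal U" and V: "block_offdiagonal V"
    and Q: "Q = \<i> \<cdot>\<^sub>C (jmat ** R) - jpow p ** U" and c0: "c0 = (\<i> / 2) \<cdot>\<^sub>C (jpow (p + 1) ** V)"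
  shows "Q ** c0 - c0 ** Q = \<i> \<cdot>\<^sub>C (jmat ** (((-1) ^ p / 2) *\<^sub>R (V ** U + U ** V)))
    - jpow p ** ((1 / 2) *\<^sub>R (V ** R + R ** V))"
  using p
  by (auto simp: c0 Q jpow_simps mm_expand cscale_simps block_diagonal_commute[OF R]
      block_offdiagonal_anticommute[OF U] block_offdiagonal_anticommute[OF V] cscale_minus_left)

lemma parts_of_sum:
  assumes p: "p \<in> {0, 1}" and R: "block_diagonal R" and U: "block_offdiagonal U"
  shows "diag_part (\<i> \<cdot>\<^sub>C (jmat ** R) - jpow p ** U) = R"
    "offdiag_part p (\<i> \<cdot>\<^sub>C (jmat ** R) - jpow p ** U) = U"
  using p
  by (auto simp: diag_part_def offdiag_part_def jpow_simps mm_expand cscale_simps block_diagonal_commute[OF R]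
      block_offdiagonal_anticommute[OF U] cscale_minus_left intro!: matrix_eq_nthI)
    (simp_all add: cscale_nth field_simps)

lemma block_parts:
  assumes p: "p \<in> {0, 1}"
  shows "block_diagonal (diag_part Q)" "block_offdiagonal (offdiag_part p Q)"
    "Q = \<i> \<cdot>\<^sub>C (jmat ** diag_part Q) - jpow p ** offdiag_part p Q"
  using p
  by (auto simp: diag_part_def offdiag_part_def block_diagonal_iff block_offdiagonal_iff jpow_simps mm_expand cscale_simps
       cscale_minus_left intro!: matrix_eq_nthI)
    (simp_all add: cscale_nth field_simps)

lemma block_diagonal_product:
  assumes "block_offdiagonal U" "block_offdiagonal V"
  shows "block_diagonal (r *\<^sub>R (V ** U + U ** V))"
  using assms
  by (simp add: block_diagonal_iff mm_expand scaleR_eq_cscale cscale_simps block_offdiagonal_anticommute)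

lemma block_offdiagonal_product:
  assumes "block_diagonal R" "block_offdiagonal V"
  shows "block_offdiagonal (r *\<^sub>R (V ** R + R ** V))"
  using assms
  by (simp add: block_offdiagonal_iff mm_expand scaleR_eq_cscale cscale_simps block_offdiagonal_anticommute block_diagonal_commute)

lemma V_new_block:
  assumes p: "p \<in> {0, 1}" and V: "block_offdiagonal V"
  shows "block_offdiagonal (V + (1 / 2) *\<^sub>R (jpow p ** (X - jmat ** X ** jmat)))"
  using p block_offdiagonal_anticommute[OF V]
  by (auto simp: block_offdiagonal_iff mm_expand cscale_simps jpow_simps)

text \<open>
  Explains the definition of \<open>V_new\<close>: adding \<open>j\<^sup>p (X - j X j) / 2\<close> to \<open>V\<close> amounts to subtracting \<open>[q1, X]\<close> from
  \<open>q0\<close>.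
\<close>

lemma q0_new_algebra:
  assumes p: "p \<in> {0, 1}"
  shows "(\<i> / 2) \<cdot>\<^sub>C (jpow (p + 1) ** V) - q1 ** X + X ** q1
    = (\<i> / 2) \<cdot>\<^sub>C (jpow (p + 1) ** (V + (1 / 2) *\<^sub>R (jpow p ** (X - jmat ** X ** jmat))))"
  using p
  by (auto simp: q1_def mm_expand cscale_simps jpow_simps cscale_minus_left)

lemma V_new_t_algebra:
  assumes p: "p \<in> {0, 1}"
  shows "(- 2 * \<i>) \<cdot>\<^sub>C (jpow (p + 1) ** (q1 ** Q - Q ** q1)) = offdiag_part p Q"
  using p
  by (auto simp: q1_def offdiag_part_def mm_expand cscale_simps jpow_simps cscale_minus_left)

lemma V_from_q0:
  assumes p: "p \<in> {0, 1}"
  shows "(- 2 * \<i>) \<cdot>\<^sub>C (jpow (p + 1) ** ((\<i> / 2) \<cdot>\<^sub>C (jpow (p + 1) ** V))) = V"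
  using p
  by (auto simp: mm_expand cscale_simps jpow_simps cscale_minus_left)

section \<open>Well-posedness of the linear systems and of wave functions\<close>

lemma interval_at_0_ereal:
  assumes "a < 0" "0 < b"
  shows "interval_at_0 {x. a < ereal x \<and> ereal x < b}"
  unfolding interval_at_0_def
proof (intro conjI)
  show "open {x. a < ereal x \<and> ereal x < b}"
    by (intro open_Collect_conj open_Collect_less continuous_intros continuous_on_ereal)
  show "convex {x. a < ereal x \<and> ereal x < b}"
    unfolding is_interval_convex_1[symmetric] is_interval_1
    by (auto intro: less_le_trans[of a "ereal _"] le_less_trans[of "ereal _" "ereal _" b])
qed (use assms in \<open>simp add: zero_ereal_def\<close>)

lemma adj_q1 [simp]: "adj q1 = - q1"
  by (simp add: q1_def adj_cscale adj_minus cscale_minus_left)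

lemma Gmat_eq: "Gmat p V x t l = - (q0 p V x t + l \<cdot>\<^sub>C q1)"
  by (simp add: Gmat_def q0_def q1_def cscale_minus_left) (simp add: cscale_def vec_eq_iff)

lemma Fmat_eq: "Fmat p R V x t l = - ((1 / l) \<cdot>\<^sub>C Qm1 p R V x t)"
  by (simp add: Fmat_def Qm1_def cscale_simps cscale_minus_left)

lemma has_pd_adj:
  "has_pd_x (\<lambda>x t. adj (f x t)) d x t \<longleftrightarrow> has_pd_x f (adj d) x t"
  "has_pd_t (\<lambda>x t. adj (f x t)) d x t \<longleftrightarrow> has_pd_t f (adj d) x t"
  using bounded_linear.has_vector_derivative[OF bounded_linear_adj, of "\<lambda>s. f s t" "adj d" "at x"]
    bounded_linear.has_vector_derivative[OF bounded_linear_adj, of "\<lambda>s. adj (f s t)" d "at x"]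
    bounded_linear.has_vector_derivative[OF bounded_linear_adj, of "\<lambda>s. f x s" "adj d" "at t"]
    bounded_linear.has_vector_derivative[OF bounded_linear_adj, of "\<lambda>s. adj (f x s)" d "at t"]
  unfolding has_pd_x_def has_pd_t_def adj_adj by blast+

text \<open>
  Off-diagonality of \<open>V\<^sub>t\<close> is inherited from \<open>V\<close> on an open set of values of \<open>t\<close>; after that the commutator
  identities are the equations themselves.
\<close>

lemma mcde_imp_zero_curvature:
  fixes R V :: "real \<Rightarrow> real \<Rightarrow> complex ^ ('m1::finite + 'm2::finite) ^ ('m1 + 'm2)"
  assumes J: "open J" and p: "p \<in> {0, 1}"
    and Rb: "\<And>x t. x \<in> I \<Longrightarrow> t \<in> J \<Longrightarrow> block_diagonal (R x t)"
    and Vb: "\<And>x t. x \<in> I \<Longrightarrow> t \<in> J \<Longrightarrow> block_offdiagonal (V x t)"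
    and Rc: "continuous_on (I \<times> J) (\<lambda>(x, t). R x t)"
    and Vc: "continuous_on (I \<times> J) (\<lambda>(x, t). V x t)"
    and Uc: "continuous_on (I \<times> J) (\<lambda>(x, t). pd_t V x t)"
    and mcde: "mcde (I \<times> J) p R V"
  shows "zero_curvature I J q1 (q0 p V) (Qm1 p R V)"
  unfolding zero_curvature_def
proof (intro conjI ballI)
  show "continuous_on (I \<times> J) (\<lambda>(x, t). q0 p V x t)"
    using Vc unfolding q0_def case_prod_unfold
    by (intro bounded_linear.continuous_on[OF bounded_linear_cscale] continuous_on_mm continuous_on_const)
  show "continuous_on (I \<times> J) (\<lambda>(x, t). Qm1 p R V x t)"
    using Rc Uc unfolding Qm1_def case_prod_unfold
    by (intro continuous_on_diff bounded_linear.continuous_on[OF bounded_linear_cscale] continuous_on_mm continuous_on_const)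
  fix x t assume xt: "x \<in> I" "t \<in> J"
  let ?U = "pd_t V x t"
  have Vt: "(V x has_vector_derivative ?U) (at t)"
    using mcde xt by (auto simp: mcde_def pd_t_def vector_derivative_works[symmetric])
  have Rx: "((\<lambda>x. R x t) has_vector_derivative ((-1) ^ p / 2) *\<^sub>R (V x t ** ?U + ?U ** V x t)) (at x)"
    and Ux: "((\<lambda>x. pd_t V x t) has_vector_derivative (1 / 2) *\<^sub>R (V x t ** R x t + R x t ** V x t)) (at x)"
    using mcde xt by (auto simp: mcde_def has_pd_x_def)
  have Ub: "block_offdiagonal ?U"
  proof -
    have "((\<lambda>s. jmat ** V x s + V x s ** jmat) has_vector_derivative
        (jmat ** ?U + 0 ** V x t) + (V x t ** 0 + ?U ** jmat)) (at t)"
      by (intro has_vector_derivative_add has_vector_derivative_mm Vt has_vector_derivative_const)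
    moreover have "((\<lambda>s. jmat ** V x s + V x s ** jmat) has_vector_derivative 0) (at t)"
      by (rule has_vector_derivative_transform_within_open[OF has_vector_derivative_const[of 0] J xt(2)])
        (use xt Vb in \<open>simp add: block_offdiagonal_iff\<close>)
    ultimately have "jmat ** ?U + ?U ** jmat = 0"
      using vector_derivative_unique_at by fastforce
    then show ?thesis by (simp add: block_offdiagonal_iff eq_neg_iff_add_eq_0 add.commute)
  qed
  show "has_pd_t (q0 p V) (q1 ** Qm1 p R V x t - Qm1 p R V x t ** q1) x t"
    unfolding curvature_t_algebra[OF p Rb[OF xt] Ub Qm1_def[of p R V x t]]
    unfolding has_pd_t_def q0_def
  proof (rule bounded_linear.has_vector_derivative[OF bounded_linear_cscale])
    show "((\<lambda>s. jpow (p + 1) ** V x s) has_vector_derivative jpow (p + 1) ** ?U) (at t)"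
      using has_vector_derivative_mm[OF has_vector_derivative_const[of "jpow (p + 1)"] Vt] by (simp add: mm.zero_left)
  qed
  show "has_pd_x (Qm1 p R V) (Qm1 p R V x t ** q0 p V x t - q0 p V x t ** Qm1 p R V x t) x t"
    unfolding curvature_x_algebra[OF p Rb[OF xt] Ub Vb[OF xt] Qm1_def[of p R V x t] q0_def[of p V x t]]
    unfolding has_pd_x_def Qm1_def
  proof (intro has_vector_derivative_diff bounded_linear.has_vector_derivative[OF bounded_linear_cscale])
    show "((\<lambda>x. jmat ** R x t) has_vector_derivative jmat ** (((-1) ^ p / 2) *\<^sub>R (V x t ** ?U + ?U ** V x t))) (at x)"
      using has_vector_derivative_mm[OF has_vector_derivative_const[of jmat] Rx] by (simp add: mm.zero_left)
    show "((\<lambda>x. jpow p ** pd_t V x t) has_vector_derivative jpow p ** ((1 / 2) *\<^sub>R (V x t ** R x t + R x t ** V x t))) (at x)"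
      using has_vector_derivative_mm[OF has_vector_derivative_const[of "jpow p"] Ux] by (simp add: mm.zero_left)
  qed
qed

text \<open>
  Puts both \<open>\<Pi>\<^sub>1\<close> and \<open>\<Pi>\<^sub>2\<close> into the common form, the latter with the adjoint coefficients.
\<close>

lemma linear_systems_iff:
  fixes A2 :: "complex ^ 'n::finite ^ 'n"
  assumes "invertible A2"
  shows "linear_systems (I \<times> J) p R V A1 A2 P1 P2 S \<longleftrightarrow>
    right_system I J q1 (q0 p V) (Qm1 p R V) A1 P1 \<and>
    right_system I J (- adj q1) (\<lambda>x t. - adj (q0 p V x t)) (\<lambda>x t. - adj (Qm1 p R V x t)) (adj A2) P2 \<and>
    (\<forall>x\<in>I. \<forall>t\<in>J. has_pd_x S (P1 x t ** q1 ** adj (P2 x t)) x t \<and>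
      has_pd_t S (- (matrix_inv A1 ** P1 x t ** Qm1 p R V x t ** adj (P2 x t) ** matrix_inv A2)) x t)"
  unfolding linear_systems_def right_system_def by (auto simp: mm.minus_right)

lemma invertible_mat: "l \<noteq> 0 \<Longrightarrow> invertible (mat l :: complex ^ 'm::finite ^ 'm)"
  and matrix_inv_mat: "l \<noteq> 0 \<Longrightarrow> matrix_inv (mat l :: complex ^ 'm::finite ^ 'm) = mat (1 / l)"
proof -
  have *: "mat a ** mat b = (mat (a * b) :: complex ^ 'm ^ 'm)" for a b
    by (subst mat_mult_left) (simp add: cscale_def mat_def vec_eq_iff)
  show "invertible (mat l :: complex ^ 'm::finite ^ 'm)" if "l \<noteq> 0"
    unfolding invertible_def by (rule exI[of _ "mat (1 / l)"]) (use that in \<open>simp add: *\<close>)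
  show "matrix_inv (mat l :: complex ^ 'm::finite ^ 'm) = mat (1 / l)" if "l \<noteq> 0"
    by (rule matrix_inv_eqI) (use that in \<open>simp_all add: *\<close>)
qed

text \<open>
  A wave function has its coefficients on the left, so its adjoint solves the adjoint system; the scalar matrix
  of the conjugate of \<open>l\<close> plays the role of the constant matrix.
\<close>

lemma wave_function_iff:
  assumes l: "l \<noteq> 0"
  shows "wave_function (I \<times> J) p R V l w \<longleftrightarrow> det (w 0 0) \<noteq> 0 \<and>
    right_system I J (- adj q1) (\<lambda>x t. - adj (q0 p V x t)) (\<lambda>x t. - adj (Qm1 p R V x t))
      (mat (cnj l)) (\<lambda>x t. adj (w x t))"
proof -
  have cl: "cnj l \<noteq> 0" using l by simp
  have "adj (adj W ** - adj C + mat (cnj l) ** adj W ** - adj q1) = - (C + l \<cdot>\<^sub>C q1) ** W"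
    for W C :: "complex ^ ('a + 'b) ^ ('a + 'b)"
    by (simp add: mat_mult_left adj_add adj_diff adj_minus adj_mult adj_cscale mm_expand cscale_simps)
  moreover have "adj (matrix_inv (mat (cnj l)) ** adj W ** - adj C) = - ((1 / l) \<cdot>\<^sub>C C) ** W"
    for W C :: "complex ^ ('a + 'b) ^ ('a + 'b)"
    by (simp add: matrix_inv_mat[OF cl] mat_mult_left adj_minus adj_mult adj_cscale mm_expand cscale_simps)
  ultimately show ?thesis
    by (simp add: wave_function_def right_system_def has_pd_adj Gmat_eq Fmat_eq)
qed

lemma spec_invertible:
  fixes A :: "complex ^ 'n::finite ^ 'n"
  assumes "l \<notin> spec A"
  shows "invertible (A - mat l)"
proof -
  have "x = 0" if "(A - mat l) *v x = 0" for x
  proof (rule ccontr)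
    assume "x \<noteq> 0"
    moreover have "mat l *v x = l *s x"
      by (simp add: matrix_vector_mult_def mat_def vec_eq_iff if_distrib[of "\<lambda>a. a * _"] cong: if_cong)
    then have "A *v x = l *s x" using that by (simp add: matrix_vector_mult_diff_rdistrib)
    ultimately show False using assms by (auto simp: spec_def)
  qed
  then show ?thesis by (simp add: invertible_left_inverse matrix_left_invertible_ker)
qed

lemma right_system_dual_adj:
  assumes A: "invertible A" and xt: "x \<in> I" "t \<in> J"
    and Y: "right_system I J (- adj c1) (\<lambda>x t. - adj (c0 x t)) (\<lambda>x t. - adj (Q x t)) (adj A) Y"
  shows "((\<lambda>x. adj (Y x t)) has_vector_derivative - (c0 x t ** adj (Y x t)) - c1 ** adj (Y x t) ** A) (at x)"
    and "((\<lambda>t. adj (Y x t)) has_vector_derivative - (Q x t ** adj (Y x t) ** matrix_inv A)) (at t)"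
proof -
  have "has_pd_x Y (Y x t ** - adj (c0 x t) + adj A ** Y x t ** - adj c1) x t"
    and "has_pd_t Y (matrix_inv (adj A) ** Y x t ** - adj (Q x t)) x t"
    using Y xt unfolding right_system_def by blast+
  from bounded_linear.has_vector_derivative[OF bounded_linear_adj this(1)[unfolded has_pd_x_def]]
    bounded_linear.has_vector_derivative[OF bounded_linear_adj this(2)[unfolded has_pd_t_def]]
  show "((\<lambda>x. adj (Y x t)) has_vector_derivative - (c0 x t ** adj (Y x t)) - c1 ** adj (Y x t) ** A) (at x)"
    and "((\<lambda>t. adj (Y x t)) has_vector_derivative - (Q x t ** adj (Y x t) ** matrix_inv A)) (at t)"
    by (simp_all add: adj_add adj_diff adj_minus adj_mult mm_expand matrix_inv_adj[OF A] minus_diff_commute)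
qed

text \<open>
  Given \<open>\<Pi>\<^sub>1\<close> and \<open>\<Pi>\<^sub>2\<close>, the prescribed derivatives of \<open>S\<close> form a closed form: the mixed derivative, named \<open>?h\<close>
  in the proof, comes out the same in either order because the terms with \<open>q0\<close> in the \<open>x\<close>-derivative of the second
  component cancel against \<open>Q\<^sub>x = [Q, q0]\<close>.
\<close>

lemma linear_systems_well_posed:
  fixes R V :: "real \<Rightarrow> real \<Rightarrow> complex ^ ('m1::finite + 'm2::finite) ^ ('m1 + 'm2)"
    and A1 A2 S0 :: "complex ^ 'n::finite ^ 'n"
  assumes cf: "curvature_free I J q1 (q0 p V) (Qm1 p R V)"
    and A1: "invertible A1" and A2: "invertible A2"
  shows "\<exists>P1 P2 S. linear_systems (I \<times> J) p R V A1 A2 P1 P2 S \<and>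
        P1 0 0 = P10 \<and> P2 0 0 = P20 \<and> S 0 0 = S0 \<and>
        (\<forall>P1' P2' S'. linear_systems (I \<times> J) p R V A1 A2 P1' P2' S' \<and>
            P1' 0 0 = P10 \<and> P2' 0 0 = P20 \<and> S' 0 0 = S0 \<longrightarrow>
            (\<forall>(x, t) \<in> I \<times> J. P1' x t = P1 x t \<and> P2' x t = P2 x t \<and> S' x t = S x t))"
proof -
  interpret curvature_free I J q1 "q0 p V" "Qm1 p R V" by (rule cf)
  interpret dual: curvature_free I J "- adj q1" "\<lambda>x t. - adj (q0 p V x t)" "\<lambda>x t. - adj (Qm1 p R V x t)"
    by (rule curvature_free_dual)
  let ?Q = "Qm1 p R V"
  obtain P1 where P1: "P1 0 0 = P10" "continuous_on (I \<times> J) (\<lambda>(x, t). P1 x t)"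
      "right_system I J q1 (q0 p V) ?Q A1 P1"
    using right_system_exists[OF A1] .
  obtain P2 where P2: "P2 0 0 = P20" "continuous_on (I \<times> J) (\<lambda>(x, t). P2 x t)"
      "right_system I J (- adj q1) (\<lambda>x t. - adj (q0 p V x t)) (\<lambda>x t. - adj (?Q x t)) (adj A2) P2"
    using dual.right_system_exists[OF invertible_adj[OF A2]] .
  let ?Z = "\<lambda>x t. adj (P2 x t)"
  let ?B1 = "matrix_inv A1" and ?B2 = "matrix_inv A2"
  let ?h = "\<lambda>x t. P1 x t ** q1 ** - (?Q x t ** ?Z x t ** ?B2) + ?B1 ** P1 x t ** ?Q x t ** q1 ** ?Z x t"
  have Z_c: "continuous_on (I \<times> J) (\<lambda>(x, t). ?Z x t)"
    using P2(2) unfolding case_prod_unfold by (rule bounded_linear.continuous_on[OF bounded_linear_adj])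
  note Z_x = right_system_dual_adj(1)[OF A2 _ _ P2(3)] and Z_t = right_system_dual_adj(2)[OF A2 _ _ P2(3)]
  have P_x: "((\<lambda>x. P1 x t) has_vector_derivative P1 x t ** q0 p V x t + A1 ** P1 x t ** q1) (at x)"
    and P_t: "((\<lambda>t. P1 x t) has_vector_derivative ?B1 ** P1 x t ** ?Q x t) (at t)" if "x \<in> I" "t \<in> J" for x t
    using P1(3) that unfolding right_system_def has_pd_x_def has_pd_t_def by blast+
  obtain S where S: "S 0 0 = S0"
    "\<And>x t. x \<in> I \<Longrightarrow> t \<in> J \<Longrightarrow> ((\<lambda>x. S x t) has_vector_derivative P1 x t ** q1 ** ?Z x t) (at x)"
    "\<And>x t. x \<in> I \<Longrightarrow> t \<in> J \<Longrightarrow>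
      ((\<lambda>t. S x t) has_vector_derivative - (?B1 ** P1 x t ** ?Q x t ** ?Z x t ** ?B2)) (at t)"
  proof (rule closed_form_potential[OF I J, where f = "\<lambda>x t. P1 x t ** q1 ** ?Z x t" and c = S0 and h = ?h
        and g = "\<lambda>x t. - (?B1 ** P1 x t ** ?Q x t ** ?Z x t ** ?B2)"])
    show "continuous_on (I \<times> J) (\<lambda>(x, t). P1 x t ** q1 ** ?Z x t)"
      "continuous_on (I \<times> J) (\<lambda>(x, t). - (?B1 ** P1 x t ** ?Q x t ** ?Z x t ** ?B2))"
      "continuous_on (I \<times> J) (\<lambda>(x, t). ?h x t)"
      using P1(2) Z_c Q_cont unfolding case_prod_unfold
      by (auto intro!: continuous_on_add continuous_on_minus continuous_on_mm continuous_on_const)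
    fix x t assume xt: "x \<in> I" "t \<in> J"
    show "((\<lambda>t. P1 x t ** q1 ** ?Z x t) has_vector_derivative ?h x t) (at t)"
      using has_vector_derivative_mm[OF has_vector_derivative_mm[OF P_t[OF xt] has_vector_derivative_const[of q1]] Z_t[OF xt]]
      by (simp add: mm_expand)
    have cancel: "?B1 ** (A1 ** M) = M" for M :: "complex ^ 'n ^ 'n"
      using A1 by (simp add: matrix_mul_assoc matrix_inv_inverse)
    show "((\<lambda>x. - (?B1 ** P1 x t ** ?Q x t ** ?Z x t ** ?B2)) has_vector_derivative ?h x t) (at x)"
      using has_vector_derivative_minus[OF has_vector_derivative_mm[OF has_vector_derivative_mm[OF has_vector_derivative_mm[OF
          has_vector_derivative_mm[OF has_vector_derivative_const[of ?B1] P_x[OF xt]] Q_x[OF xt]] Z_x[OF xt]]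
          has_vector_derivative_const[of ?B2]]]
      by (simp add: mm_expand cancel matrix_inv_inverse[OF A2])
  qed (rule that)
  have lin: "linear_systems (I \<times> J) p R V A1 A2 P1 P2 S"
    unfolding linear_systems_iff[OF A2] using P1(3) P2(3) S(2,3) by (simp add: has_pd_x_def has_pd_t_def)
  have "P1' x t = P1 x t \<and> P2' x t = P2 x t \<and> S' x t = S x t"
    if lin': "linear_systems (I \<times> J) p R V A1 A2 P1' P2' S'" and init: "P1' 0 0 = P10" "P2' 0 0 = P20" "S' 0 0 = S0"
      and xt: "x \<in> I" "t \<in> J" for P1' P2' S' x t
  proof -
    note L = lin'[unfolded linear_systems_iff[OF A2]]
    have 1: "P1' x t = P1 x t" if "x \<in> I" "t \<in> J" for x t
      using right_system_unique[OF conjunct1[OF L] P1(3) _ that] init P1(1) by simp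
    have 2: "P2' x t = P2 x t" if "x \<in> I" "t \<in> J" for x t
      using dual.right_system_unique[OF conjunct1[OF conjunct2[OF L]] P2(3) _ that] init P2(1) by simp
    have "S' x t - S x t = 0"
    proof (rule total_system_zero[OF I J, where A = "\<lambda>x t. 0" and B = "\<lambda>x t. 0"])
      fix x t assume xt: "x \<in> I" "t \<in> J"
      have "((\<lambda>x. S' x t) has_vector_derivative P1 x t ** q1 ** ?Z x t) (at x)"
        "((\<lambda>t. S' x t) has_vector_derivative - (?B1 ** P1 x t ** ?Q x t ** ?Z x t ** ?B2)) (at t)"
        using L xt by (auto simp: has_pd_x_def has_pd_t_def 1 2)
      from has_vector_derivative_diff[OF this(1) S(2)[OF xt]] has_vector_derivative_diff[OF this(2) S(3)[OF xt]]
      show "((\<lambda>x. S' x t - S x t) has_vector_derivative blinfun_apply 0 (S' x t - S x t)) (at x)"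
        "((\<lambda>t. S' x t - S x t) has_vector_derivative blinfun_apply 0 (S' x t - S x t)) (at t)"
        by simp_all
    qed (use S(1) init xt in auto)
    then show ?thesis using 1[OF xt] 2[OF xt] by simp
  qed
  then show ?thesis using lin P1(1) P2(1) S(1) by blast
qed

lemma wave_function_well_posed:
  fixes R V :: "real \<Rightarrow> real \<Rightarrow> complex ^ ('m1::finite + 'm2::finite) ^ ('m1 + 'm2)"
  assumes cf: "curvature_free I J q1 (q0 p V) (Qm1 p R V)" and l: "l \<noteq> 0" and W0: "det W0 \<noteq> 0"
  shows "\<exists>w. wave_function (I \<times> J) p R V l w \<and> w 0 0 = W0 \<and>
    (\<forall>w'. wave_function (I \<times> J) p R V l w' \<and> w' 0 0 = W0 \<longrightarrow> (\<forall>(x, t) \<in> I \<times> J. w' x t = w x t))"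
proof -
  interpret dual: curvature_free I J "- adj q1" "\<lambda>x t. - adj (q0 p V x t)" "\<lambda>x t. - adj (Qm1 p R V x t)"
    using cf by (rule curvature_free.curvature_free_dual)
  have inv: "invertible (mat (cnj l) :: complex ^ ('m1 + 'm2) ^ ('m1 + 'm2))" by (rule invertible_mat) (use l in simp)
  obtain Y where Y: "Y 0 0 = adj W0" and "continuous_on (I \<times> J) (\<lambda>(x, t). Y x t)"
    and sys: "right_system I J (- adj q1) (\<lambda>x t. - adj (q0 p V x t)) (\<lambda>x t. - adj (Qm1 p R V x t)) (mat (cnj l)) Y"
    using dual.right_system_exists[OF inv] .
  show ?thesis
  proof (intro exI[of _ "\<lambda>x t. adj (Y x t)"] conjI allI impI)
    show "wave_function (I \<times> J) p R V l (\<lambda>x t. adj (Y x t))"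
      using Y sys W0 by (simp add: wave_function_iff[OF l])
    fix w' assume w': "wave_function (I \<times> J) p R V l w' \<and> w' 0 0 = W0"
    have eq: "adj (w' x t) = Y x t" if "x \<in> I" "t \<in> J" for x t
      using dual.right_system_unique[OF _ sys _ that, of "\<lambda>x t. adj (w' x t)"] w' Y
      by (simp add: wave_function_iff[OF l])
    have "w' x t = adj (Y x t)" if "x \<in> I" "t \<in> J" for x t
      using arg_cong[OF eq[OF that], of adj] by simp
    then show "\<forall>(x, t) \<in> I \<times> J. w' x t = adj (Y x t)" by auto
  qed (use Y in simp)
qed

section \<open>The transformed solution\<close>

text \<open>
  Zero curvature of the transformed coefficients is translated back by splitting \<open>Q'\<close> into its parts. Its
  off-diagonal part is identified with the \<open>t\<close>-derivative of \<open>V_new\<close> first, since that derivative enters the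
  equations to be proved.
\<close>

lemma gbdt_transformation:
  fixes R V :: "real \<Rightarrow> real \<Rightarrow> complex ^ ('m1::finite + 'm2::finite) ^ ('m1 + 'm2)"
    and A1 A2 :: "complex ^ 'n::finite ^ 'n"
  assumes cf: "curvature_free I J q1 (q0 p V) (Qm1 p R V)"
    and p: "p \<in> {0, 1}"
    and Vb: "\<forall>x\<in>I. \<forall>t\<in>J. block_offdiagonal (V x t)"
    and A1: "invertible A1" and A2: "invertible A2"
    and lin: "linear_systems (I \<times> J) p R V A1 A2 P1 P2 S"
    and S0: "invertible (S 0 0)" and syl: "A1 ** S 0 0 - S 0 0 ** A2 = P1 0 0 ** adj (P2 0 0)"
  defines "D' \<equiv> {(x, t) \<in> I \<times> J. invertible (S x t)}"
    and "R' \<equiv> R_new p R V A1 A2 P1 P2 S" and "V' \<equiv> V_new p V P1 P2 S"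
  shows "\<forall>(x, t) \<in> D'. block_diagonal (R' x t) \<and> block_offdiagonal (V' x t)"
    and "mcde D' p R' V'"
    and "l \<notin> {0} \<union> spec A1 \<union> spec A2 \<Longrightarrow> wave_function (I \<times> J) p R V l w \<Longrightarrow>
      wave_function D' p R' V' l (\<lambda>x t. darboux A1 P1 P2 S x t l ** w x t)"
proof -
  let ?Z = "\<lambda>x t. adj (P2 x t)"
  let ?B1 = "matrix_inv A1" and ?B2 = "matrix_inv A2"
  interpret base: curvature_free I J q1 "q0 p V" "Qm1 p R V" by (rule cf)
  have I: "interval_at_0 I" and J: "interval_at_0 J" by (rule base.I base.J)+
  interpret gbdt I J q1 "q0 p V" "Qm1 p R V" A1 A2 ?B1 ?B2 P1 ?Z S
  proof unfold_locales
    fix x t assume xt: "x \<in> I" "t \<in> J"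
    note sys = lin[unfolded linear_systems_iff[OF A2]]
    show "((\<lambda>x. ?Z x t) has_vector_derivative - (q0 p V x t ** ?Z x t) - q1 ** ?Z x t ** A2) (at x)"
      "((\<lambda>t. ?Z x t) has_vector_derivative - (Qm1 p R V x t ** ?Z x t ** ?B2)) (at t)"
      using right_system_dual_adj[OF A2 xt] sys by blast+
    show "((\<lambda>x. P1 x t) has_vector_derivative P1 x t ** q0 p V x t + A1 ** P1 x t ** q1) (at x)"
      "((\<lambda>t. P1 x t) has_vector_derivative ?B1 ** P1 x t ** Qm1 p R V x t) (at t)"
      "((\<lambda>x. S x t) has_vector_derivative P1 x t ** q1 ** ?Z x t) (at x)"
      "((\<lambda>t. S x t) has_vector_derivative - (?B1 ** P1 x t ** Qm1 p R V x t ** ?Z x t ** ?B2)) (at t)"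
      using sys xt unfolding right_system_def has_pd_x_def has_pd_t_def by blast+
  qed (use A1 A2 syl in \<open>simp_all add: matrix_inv_inverse\<close>)
  have D': "(x, t) \<in> D' \<longleftrightarrow> regular x t" for x t by (auto simp: D'_def regular_def)
  have Q'_new: "Q' x t = Qm1_new p R V A1 A2 P1 P2 S x t" for x t
    by (simp add: Q'_eq Qm1_new_def Xm1_def Ym1_def T_def)
  have R': "R' x t = diag_part (Q' x t)" for x t
    by (simp add: R'_def R_new_def Let_def diag_part_def Q'_new)
  have V': "V' x t = V x t + (1 / 2) *\<^sub>R (jpow p ** (K x t ** P1 x t - jmat ** (K x t ** P1 x t) ** jmat))" for x t
    by (simp add: V'_def V_new_def Let_def X0_def K_def T_def)
  have c0'_new: "c0' x t = q0 p V' x t" for x t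
    unfolding c0'_def V' q0_def using q0_new_algebra[OF p] by blast
  have R'_block: "block_diagonal (R' x t)" for x t
    unfolding R' by (rule block_parts[OF p])
  have V'_block: "block_offdiagonal (V' x t)" if "regular x t" for x t
    unfolding V' by (rule V_new_block[OF p]) (use Vb that in \<open>auto simp: regular_def\<close>)
  show "\<forall>(x, t) \<in> D'. block_diagonal (R' x t) \<and> block_offdiagonal (V' x t)"
    using R'_block V'_block D' by auto

  define U' where "U' x t = offdiag_part p (Q' x t)" for x t
  have U'_block: "block_offdiagonal (U' x t)" for x t
    unfolding U'_def by (rule block_parts[OF p])
  have Q'_split: "Q' x t = \<i> \<cdot>\<^sub>C (jmat ** R' x t) - jpow p ** U' x t" for x t
    unfolding R' U'_def by (rule block_parts[OF p])
  \<comment> \<open>Recover \<open>V'\<close> from \<open>q0'\<close>, whose \<open>t\<close>-derivative is known.\<close>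
  have V'_t: "((\<lambda>t. V' x t) has_vector_derivative U' x t) (at t)" if r: "regular x t" for x t
  proof -
    have "((\<lambda>t. (- 2 * \<i>) \<cdot>\<^sub>C (jpow (p + 1) ** c0' x t)) has_vector_derivative
        (- 2 * \<i>) \<cdot>\<^sub>C (jpow (p + 1) ** (q1 ** Q' x t - Q' x t ** q1) + 0 ** c0' x t)) (at t)"
      by (intro bounded_linear.has_vector_derivative[OF bounded_linear_cscale] has_vector_derivative_mm
          has_vector_derivative_const c0'_t[OF r])
    then show ?thesis
      unfolding c0'_new q0_def V_from_q0[OF p] mm.zero_left add_0_right V_new_t_algebra[OF p] U'_def .
  qed
  have pd_t_V': "pd_t V' x t = U' x t" if "regular x t" for x t
    unfolding pd_t_def by (rule vector_derivative_at[OF V'_t[OF that]])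
  define dR dU where "dR x t = ((-1) ^ p / 2) *\<^sub>R (V' x t ** U' x t + U' x t ** V' x t)"
    and "dU x t = (1 / 2) *\<^sub>R (V' x t ** R' x t + R' x t ** V' x t)" for x t
  have Q'_x_split: "((\<lambda>x. Q' x t) has_vector_derivative \<i> \<cdot>\<^sub>C (jmat ** dR x t) - jpow p ** dU x t) (at x)"
    if r: "regular x t" for x t
    using Q'_x[OF r]
    unfolding c0'_new curvature_x_algebra[OF p R'_block U'_block V'_block[OF r] Q'_split[of x t] q0_def[of p V' x t]] dR_def dU_def .
  have linear_parts: "bounded_linear (diag_part :: complex ^ ('m1 + 'm2) ^ ('m1 + 'm2) \<Rightarrow> _)"
    "bounded_linear (offdiag_part p :: complex ^ ('m1 + 'm2) ^ ('m1 + 'm2) \<Rightarrow> _)"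
    unfolding linear_conv_bounded_linear[symmetric] linear_iff
    by (simp_all add: diag_part_def offdiag_part_def mm_expand mm.scaleR_left mm.scaleR_right cscale_simps)
      (simp_all add: mult.commute)
  have dR_block: "block_diagonal (dR x t)" and dU_block: "block_offdiagonal (dU x t)" if "regular x t" for x t
    unfolding dR_def dU_def
    by (intro block_diagonal_product block_offdiagonal_product U'_block R'_block V'_block that)+
  have R'_x: "((\<lambda>x. R' x t) has_vector_derivative dR x t) (at x)"
    and U'_x: "((\<lambda>x. U' x t) has_vector_derivative dU x t) (at x)" if r: "regular x t" for x t
    using bounded_linear.has_vector_derivative[OF linear_parts(1) Q'_x_split[OF r]]
      bounded_linear.has_vector_derivative[OF linear_parts(2) Q'_x_split[OF r]]
    unfolding parts_of_sum[OF p dR_block[OF r] dU_block[OF r]] R' U'_def .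
  \<comment> \<open>The operator \<open>pd_t\<close> agrees with \<open>U'\<close> only at regular points, so an interval of such points around
    \<open>x\<close> is needed before differentiating in \<open>x\<close>.\<close>
  have pd_t_V'_x: "((\<lambda>x. pd_t V' x t) has_vector_derivative dU x t) (at x)" if r: "regular x t" for x t
  proof -
    have "isCont (\<lambda>x. S x t) x"
      by (rule has_vector_derivative_continuous[OF S_x]) (use r in \<open>auto simp: regular_def\<close>)
    then have "eventually (\<lambda>r. invertible (S r t)) (nhds x)"
      by (rule eventually_invertible) (use r in \<open>auto simp: regular_def\<close>)
    then obtain N where N: "open N" "x \<in> N" "\<And>r. r \<in> N \<Longrightarrow> invertible (S r t)"
      by (auto simp: eventually_nhds)
    show ?thesis
    proof (rule has_vector_derivative_transform_within_open[OF U'_x[OF r]])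
      show "open (N \<inter> I)" using N I by (auto simp: interval_at_0_def)
      show "x \<in> N \<inter> I" using N r by (auto simp: regular_def)
      show "U' y t = pd_t V' y t" if "y \<in> N \<inter> I" for y
        using pd_t_V'[of y t] that N r by (auto simp: regular_def)
    qed
  qed
  show "mcde D' p R' V'"
    unfolding mcde_def
  proof clarify
    fix x t assume "(x, t) \<in> D'"
    then have r: "regular x t" by (simp add: D')
    show "V' x differentiable at t \<and>
      has_pd_x R' (((-1) ^ p / 2) *\<^sub>R (V' x t ** pd_t V' x t + pd_t V' x t ** V' x t)) x t \<and>
      has_pd_x (pd_t V') ((1 / 2) *\<^sub>R (V' x t ** R' x t + R' x t ** V' x t)) x t"
      using V'_t[OF r] R'_x[OF r] pd_t_V'_x[OF r]
      by (auto simp: has_pd_x_def pd_t_V'[OF r] dR_def dU_def intro: differentiableI_vector)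
  qed

  assume l: "l \<notin> {0} \<union> spec A1 \<union> spec A2" and w: "wave_function (I \<times> J) p R V l w"
  let ?M = "matrix_inv (A1 - mat l)" and ?N = "matrix_inv (A2 - mat l)"
  have l0: "l \<noteq> 0" using l by simp
  have i1: "invertible (A1 - mat l)" and i2: "invertible (A2 - mat l)"
    using l by (auto intro: spec_invertible)
  have M: "A1 ** ?M = mat 1 + l \<cdot>\<^sub>C ?M" "?M ** A1 = mat 1 + l \<cdot>\<^sub>C ?M"
    using matrix_inv_inverse[OF i1]
    by (simp_all add: mm.diff_left mm.diff_right mat_mult_left mat_mult_right diff_eq_eq)
  have dar: "darboux A1 P1 P2 S x t l = dbx ?M x t" for x t
    by (simp add: darboux_def dbx_def K_def T_def)
  show "wave_function D' p R' V' l (\<lambda>x t. darboux A1 P1 P2 S x t l ** w x t)"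
    unfolding wave_function_def
  proof (intro conjI)
    have r0: "regular 0 0" using S0 I J by (simp add: regular_def interval_at_0_def)
    \<comment> \<open>The Sylvester identity shifted by \<open>l\<close> shows that the Darboux matrix is invertible at the origin.\<close>
    have "(A1 - mat l) ** S 0 0 - S 0 0 ** (A2 - mat l) = P1 0 0 ** ?Z 0 0"
      using syl by (simp add: mm.diff_left mm.diff_right mat_mult_left mat_mult_right)
    then have "sylvester (A1 - mat l) (A2 - mat l) (S 0 0) (T 0 0) ?M ?N (P1 0 0) (?Z 0 0)"
      by unfold_locales (use S0 i1 i2 in \<open>simp_all add: T_def matrix_inv_inverse\<close>)
    from sylvester.darboux_inverse(2)[OF this]
    have "invertible (dbx ?M 0 0)"
      unfolding invertible_right_inverse dbx_def K_def by blast
    then have "det (dbx ?M 0 0) \<noteq> 0" by (simp add: invertible_det_nz)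
    moreover have "det (w 0 0) \<noteq> 0" using w by (simp add: wave_function_def)
    ultimately show "det (darboux A1 P1 P2 S 0 0 l ** w 0 0) \<noteq> 0"
      by (simp add: dar det_mul)
    show "\<forall>(x, t) \<in> D'. has_pd_x (\<lambda>x t. darboux A1 P1 P2 S x t l ** w x t)
            (Gmat p V' x t l ** (darboux A1 P1 P2 S x t l ** w x t)) x t \<and>
          has_pd_t (\<lambda>x t. darboux A1 P1 P2 S x t l ** w x t)
            (Fmat p R' V' x t l ** (darboux A1 P1 P2 S x t l ** w x t)) x t"
      unfolding dar
    proof (clarify, intro conjI)
      fix x t assume "(x, t) \<in> D'"
      then have r: "regular x t" by (simp add: D')
      have wx: "((\<lambda>x. w x t) has_vector_derivative - (q0 p V x t + l \<cdot>\<^sub>C q1) ** w x t) (at x)"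
        and wt: "((\<lambda>t. w x t) has_vector_derivative - ((1 / l) \<cdot>\<^sub>C Qm1 p R V x t) ** w x t) (at t)"
        using w r by (auto simp: wave_function_def has_pd_x_def has_pd_t_def Gmat_eq Fmat_eq regular_def)
      have "Qm1 p R' V' x t = Q' x t"
        by (simp add: Qm1_def pd_t_V'[OF r] Q'_split)
      then have F: "Fmat p R' V' x t l = - ((1 / l) \<cdot>\<^sub>C Q' x t)" by (simp add: Fmat_eq)
      show "has_pd_x (\<lambda>x t. dbx ?M x t ** w x t) (Gmat p V' x t l ** (dbx ?M x t ** w x t)) x t"
        using has_vector_derivative_mm[OF dbx_x[OF r M] wx]
        by (simp add: has_pd_x_def Gmat_eq c0'_new mm_expand)
      show "has_pd_t (\<lambda>x t. dbx ?M x t ** w x t) (Fmat p R' V' x t l ** (dbx ?M x t ** w x t)) x t"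
        using has_vector_derivative_mm[OF dbx_t[OF r l0 M] wt]
        by (simp add: has_pd_t_def F mm_expand cscale_simps)
    qed
  qed
qed

theorem theorem2p3:
  fixes a1 a2 b1 b2 :: ereal
    and D :: "(real \<times> real) set"
    and p :: nat
    and R V :: "real \<Rightarrow> real \<Rightarrow> complex ^ ('m1::finite + 'm2::finite) ^ ('m1 + 'm2)"
    and A1 A2 S0 :: "complex ^ 'n::finite ^ 'n"
    and P10 P20 :: "complex ^ ('m1 + 'm2) ^ 'n"
  assumes "a1 < 0" "0 < a2" "b1 < 0" "0 < b2"
    and "D = dom_rect a1 a2 b1 b2"
    and "p \<in> {0, 1}"
    and "\<And>x t. (x, t) \<in> D \<Longrightarrow> block_diagonal (R x t)"
    and "\<And>x t. (x, t) \<in> D \<Longrightarrow> block_offdiagonal (V x t)"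
    and "continuous_on D (\<lambda>(x, t). R x t)"
    and "continuous_on D (\<lambda>(x, t). V x t)"
    and "continuous_on D (\<lambda>(x, t). pd_t V x t)"
    and "mcde D p R V"
    and "invertible A1" "invertible A2" "invertible S0"
    and "A1 ** S0 - S0 ** A2 = P10 ** adj P20"
  shows
    "(\<exists>P1 P2 S. linear_systems D p R V A1 A2 P1 P2 S \<and>
        P1 0 0 = P10 \<and> P2 0 0 = P20 \<and> S 0 0 = S0 \<and>
        (\<forall>P1' P2' S'. linear_systems D p R V A1 A2 P1' P2' S' \<and>
            P1' 0 0 = P10 \<and> P2' 0 0 = P20 \<and> S' 0 0 = S0 \<longrightarrow>
            (\<forall>(x, t) \<in> D. P1' x t = P1 x t \<and> P2' x t = P2 x t \<and> S' x t = S x t)))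
     \<and>
     (\<forall>l W0. l \<noteq> 0 \<and> det W0 \<noteq> 0 \<longrightarrow>
        (\<exists>w. wave_function D p R V l w \<and> w 0 0 = W0 \<and>
          (\<forall>w'. wave_function D p R V l w' \<and> w' 0 0 = W0 \<longrightarrow>
            (\<forall>(x, t) \<in> D. w' x t = w x t))))
     \<and>
     (\<forall>P1 P2 S. linear_systems D p R V A1 A2 P1 P2 S \<and>
        P1 0 0 = P10 \<and> P2 0 0 = P20 \<and> S 0 0 = S0 \<longrightarrow>
        (let D' = {(x, t) \<in> D. invertible (S x t)};
             R' = R_new p R V A1 A2 P1 P2 S;
             V' = V_new p V P1 P2 S
         in (\<forall>(x, t) \<in> D'. block_diagonal (R' x t) \<and> block_offdiagonal (V' x t)) \<and>
            mcde D' p R' V' \<and>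
            (\<forall>l w. l \<notin> {0} \<union> spec A1 \<union> spec A2 \<and> wave_function D p R V l w \<longrightarrow>
               wave_function D' p R' V' l (\<lambda>x t. darboux A1 P1 P2 S x t l ** w x t))))"
proof -
  define I J where "I = {x. a1 < ereal x \<and> ereal x < a2}" and "J = {t. b1 < ereal t \<and> ereal t < b2}"
  have IJ: "interval_at_0 I" "interval_at_0 J"
    unfolding I_def J_def by (intro interval_at_0_ereal assms)+
  have D: "D = I \<times> J" using assms(5) by (auto simp: dom_rect_def I_def J_def)
  note hyps = assms(6-12)[unfolded D]
  have "zero_curvature I J q1 (q0 p V) (Qm1 p R V)"
    by (rule mcde_imp_zero_curvature) (use hyps IJ in \<open>auto simp: interval_at_0_def\<close>)
  then have cf: "curvature_free I J q1 (q0 p V) (Qm1 p R V)"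
    using IJ by unfold_locales
  have "\<forall>x\<in>I. \<forall>t\<in>J. block_offdiagonal (V x t)" using hyps(3) by simp
  note transformation = gbdt_transformation[OF cf \<open>p \<in> {0, 1}\<close> this \<open>invertible A1\<close> \<open>invertible A2\<close>]
  show ?thesis
    unfolding D Let_def
  proof (intro conjI allI impI)
    show "\<exists>P1 P2 S. linear_systems (I \<times> J) p R V A1 A2 P1 P2 S \<and>
        P1 0 0 = P10 \<and> P2 0 0 = P20 \<and> S 0 0 = S0 \<and>
        (\<forall>P1' P2' S'. linear_systems (I \<times> J) p R V A1 A2 P1' P2' S' \<and>
            P1' 0 0 = P10 \<and> P2' 0 0 = P20 \<and> S' 0 0 = S0 \<longrightarrow>
            (\<forall>(x, t) \<in> I \<times> J. P1' x t = P1 x t \<and> P2' x t = P2 x t \<and> S' x t = S x t))"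
      by (rule linear_systems_well_posed[OF cf \<open>invertible A1\<close> \<open>invertible A2\<close>])
  next
    fix l :: complex and W0 :: "complex ^ ('m1 + 'm2) ^ ('m1 + 'm2)" assume "l \<noteq> 0 \<and> det W0 \<noteq> 0"
    then show "\<exists>w. wave_function (I \<times> J) p R V l w \<and> w 0 0 = W0 \<and>
        (\<forall>w'. wave_function (I \<times> J) p R V l w' \<and> w' 0 0 = W0 \<longrightarrow> (\<forall>(x, t) \<in> I \<times> J. w' x t = w x t))"
      using wave_function_well_posed[OF cf] by blast
  next
    fix P1 P2 S assume sol: "linear_systems (I \<times> J) p R V A1 A2 P1 P2 S \<and> P1 0 0 = P10 \<and> P2 0 0 = P20 \<and> S 0 0 = S0"
    then have "invertible (S 0 0)" "A1 ** S 0 0 - S 0 0 ** A2 = P1 0 0 ** adj (P2 0 0)"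
      using assms(15,16) by auto
    note tr = transformation[OF conjunct1[OF sol] this]
    show "\<forall>(x, t) \<in> {(x, t) \<in> I \<times> J. invertible (S x t)}.
        block_diagonal (R_new p R V A1 A2 P1 P2 S x t) \<and> block_offdiagonal (V_new p V P1 P2 S x t)"
      by (rule tr(1))
    show "mcde {(x, t) \<in> I \<times> J. invertible (S x t)} p (R_new p R V A1 A2 P1 P2 S) (V_new p V P1 P2 S)"
      by (rule tr(2))
    show "wave_function {(x, t) \<in> I \<times> J. invertible (S x t)} p (R_new p R V A1 A2 P1 P2 S) (V_new p V P1 P2 S) l
        (\<lambda>x t. darboux A1 P1 P2 S x t l ** w x t)"
      if "l \<notin> {0} \<union> spec A1 \<union> spec A2 \<and> wave_function (I \<times> J) p R V l w" for l w
      using tr(3) that by blast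
  qed
qed

end
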